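(* Let $\mu$ be the Möbius function and $\varphi$ Euler's totient function. For a positive integer $n$ let $$\alpha_n=\frac1n\sum_{d\mid n}\varphi(d)\,2^{\frac nd-1}+(5+(-1)^n)\,2^{\lfloor\frac{n-5}{2}\rfloor},\qquad \beta_n=(5+(-1)^n)\,2^{\lfloor\frac{n-3}{2}\rfloor}$$ (rational numbers; negative exponents are allowed). Then: 1) for every integer $n\ge 2$, $N_n=-1-\sum_{d\mid n,\ d\ge 2}\mu(d)\,\alpha_{n/d}$; 2) for every integer $n\ge 2$, $S_n=-1-\sum_{d\mid n,\ d\ge 2}\mu(d)\,\beta_{n/d}$; 3) for all integers $n\ge1$ and $1\le k\le n$, $N^{(k)}_n=-\sum_{d\mid \gcd(n,k),\ d\ge 2}\mu(d)\,R\!\left(\frac nd,\frac kd\right)$.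
   Context: Place $n$ equally spaced points on a circle, labelled by $\mathbb{Z}_n$. A $(0,1)$-configuration is a map $c:\mathbb{Z}_n\to\{0,1\}$. Two configurations are congruent if one is obtained from the other by a rotation ($c'(i)=c(i+j)$) and/or a reflection in a diameter ($c'(i)=c(j-i)$), i.e. if they lie in the same orbit of the dihedral group of order $2n$. A configuration is symmetric with respect to rotation if $c(i+j)=c(i)$ for all $i$ for some $j$ with $0<j<n$ (a self-coincidence under a rotation by an angle smaller than $2\pi$). It has a diameter of symmetry if $c(j-i)=c(i)$ for all $i$ for some $j$. Both properties are invariant under congruence. $N_n$ is the number of congruence classes of $(0,1)$-configurations on $n$ points that contain at least one 1 and are symmetric with respect to rotation. $S_n$ is the number of such classes that in addition have a diameter of symmetry. $N^{(k)}_n$ is the number of congruence classes of configurations with exactly $k$ ones that are symmetric with respect to rotation. For positive integers $a\ge b$, $R(a,b)$ denotes $$R(a,b)=\frac12\left(\binom{\lfloor\frac{a-h_b}{2}\rfloor}{\lfloor\frac b2\rfloor}+\frac1b\sum_{d\mid\gcd(a,b)}\varphi(d)\binom{\frac ad-1}{\frac bd-1}\right),$$ where $h_b\in\{0,1\}$ and $h_b\equiv b\pmod 2$. This is the number of congruence classes of configurations on $a$ points with exactly $b$ ones. *)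

theory Defs
  imports "HOL-Number_Theory.Number_Theory" "HOL-Computational_Algebra.Squarefree" "HOL-Library.FuncSet"
begin

(* Z_n is represented by its least residues 0, ..., n-1; positions are added and subtracted
   modulo n.  Configurations are extensional, so equality of configurations is equality on Z_n. *)
definition Zn :: "nat \<Rightarrow> int set" where
  "Zn n = {0..<int n}"

definition configs :: "nat \<Rightarrow> (int \<Rightarrow> nat) set" where
  "configs n = Zn n \<rightarrow>\<^sub>E {0, 1}"

definition rotate_config :: "nat \<Rightarrow> int \<Rightarrow> (int \<Rightarrow> nat) \<Rightarrow> int \<Rightarrow> nat" where
  "rotate_config n j c = (\<lambda>i\<in>Zn n. c ((i + j) mod int n))"

definition reflect_config :: "nat \<Rightarrow> int \<Rightarrow> (int \<Rightarrow> nat) \<Rightarrow> int \<Rightarrow> nat" where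
  "reflect_config n j c = (\<lambda>i\<in>Zn n. c ((j - i) mod int n))"

(* The n rotations and the n reflections together make up the whole dihedral group. *)
definition congruence :: "nat \<Rightarrow> ((int \<Rightarrow> nat) \<times> (int \<Rightarrow> nat)) set" where
  "congruence n = {(c, c'). c \<in> configs n \<and> c' \<in> configs n \<and>
     (\<exists>j\<in>Zn n. c' = rotate_config n j c \<or> c' = reflect_config n j c)}"

definition ones :: "nat \<Rightarrow> (int \<Rightarrow> nat) \<Rightarrow> int set" where
  "ones n c = {i \<in> Zn n. c i = 1}"

definition rotation_symmetric :: "nat \<Rightarrow> (int \<Rightarrow> nat) \<Rightarrow> bool" where
  "rotation_symmetric n c \<longleftrightarrow>
     (\<exists>j. 0 < j \<and> j < int n \<and> (\<forall>i\<in>Zn n. c ((i + j) mod int n) = c i))"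

definition has_symmetry_diameter :: "nat \<Rightarrow> (int \<Rightarrow> nat) \<Rightarrow> bool" where
  "has_symmetry_diameter n c \<longleftrightarrow>
     (\<exists>j\<in>Zn n. \<forall>i\<in>Zn n. c ((j - i) mod int n) = c i)"

(* For a set A of configurations, A // congruence n is the set of congruence classes of
   members of A; the properties used below are invariant under congruence. *)
definition N_rot :: "nat \<Rightarrow> nat" where
  "N_rot n = card ({c \<in> configs n. ones n c \<noteq> {} \<and> rotation_symmetric n c} // congruence n)"

definition S_rot :: "nat \<Rightarrow> nat" where
  "S_rot n = card ({c \<in> configs n. ones n c \<noteq> {} \<and> rotation_symmetric n c
     \<and> has_symmetry_diameter n c} // congruence n)"

definition N_rot_ones :: "nat \<Rightarrow> nat \<Rightarrow> nat" where
  "N_rot_ones k n = card ({c \<in> configs n. card (ones n c) = k \<and> rotation_symmetric n c}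
     // congruence n)"

definition moebius :: "nat \<Rightarrow> int" where
  "moebius n = (if squarefree n then (- 1) ^ card (prime_factors n) else 0)"

(* Integer div rounds towards minus infinity, so it is the floor also for small n. *)
definition alpha_seq :: "nat \<Rightarrow> rat" where
  "alpha_seq n = 1 / of_nat n * (\<Sum>d | d dvd n. of_nat (totient d) * 2 ^ (n div d - 1))
     + (5 + (- 1) ^ n) * 2 powi ((int n - 5) div 2)"

definition beta_seq :: "nat \<Rightarrow> rat" where
  "beta_seq n = (5 + (- 1) ^ n) * 2 powi ((int n - 3) div 2)"

(* Only used for a \<ge> b \<ge> 1, so no natural-number subtraction is truncated;
   b mod 2 is the parity h_b. *)
definition R_formula :: "nat \<Rightarrow> nat \<Rightarrow> rat" where
  "R_formula a b = 1 / 2 * (of_nat (((a - b mod 2) div 2) choose (b div 2))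
     + 1 / of_nat b * (\<Sum>d | d dvd gcd a b.
         of_nat (totient d) * of_nat ((a div d - 1) choose (b div d - 1))))"

lemma mod_in_Zn: "n > 0 \<Longrightarrow> i mod int n \<in> Zn n"
  by (simp add: Zn_def)

lemma Zn_mod [simp]: "i \<in> Zn n \<Longrightarrow> i mod int n = i"
  by (simp add: Zn_def)

lemma rotate_rotate:
  "n > 0 \<Longrightarrow> rotate_config n j (rotate_config n k c) = rotate_config n ((j + k) mod int n) c"
  by (auto simp: rotate_config_def restrict_def fun_eq_iff mod_in_Zn mod_simps algebra_simps)

lemma rotate_reflect:
  "n > 0 \<Longrightarrow> rotate_config n j (reflect_config n k c) = reflect_config n ((k - j) mod int n) c"
  by (auto simp: rotate_config_def reflect_config_def restrict_def fun_eq_iff mod_in_Zn mod_simps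
      algebra_simps)

lemma reflect_rotate:
  "n > 0 \<Longrightarrow> reflect_config n j (rotate_config n k c) = reflect_config n ((j + k) mod int n) c"
  by (auto simp: rotate_config_def reflect_config_def restrict_def fun_eq_iff mod_in_Zn mod_simps
      algebra_simps)

lemma reflect_reflect:
  "n > 0 \<Longrightarrow> reflect_config n j (reflect_config n k c) = rotate_config n ((k - j) mod int n) c"
  by (auto simp: rotate_config_def reflect_config_def restrict_def fun_eq_iff mod_in_Zn mod_simps
      algebra_simps)

lemma rotate_0: "c \<in> configs n \<Longrightarrow> rotate_config n 0 c = c"
  by (auto simp: configs_def rotate_config_def restrict_def fun_eq_iff PiE_def extensional_def)

lemma equiv_congruence:
  assumes "n > 0"
  shows "equiv (configs n) (congruence n)"
proof (rule equivI)
  show "congruence n \<subseteq> configs n \<times> configs n"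
    by (auto simp: congruence_def)
  have z: "0 \<in> Zn n" using assms by (simp add: Zn_def)
  show "refl_on (configs n) (congruence n)"
    using z by (auto simp: refl_on_def congruence_def rotate_0 intro!: bexI[of _ 0])
  show "sym (congruence n)"
  proof (rule symI)
    fix c c' assume "(c, c') \<in> congruence n"
    then obtain j where c: "c \<in> configs n" "c' \<in> configs n" and j: "j \<in> Zn n"
      and d: "c' = rotate_config n j c \<or> c' = reflect_config n j c"
      by (auto simp: congruence_def)
    from d show "(c', c) \<in> congruence n"
    proof
      assume "c' = rotate_config n j c"
      then have "rotate_config n ((- j) mod int n) c' = c"
        using assms c by (simp add: rotate_rotate mod_simps rotate_0)
      then show ?thesis
        using c mod_in_Zn[OF assms, of "- j"] by (force simp: congruence_def)
    next
      assume "c' = reflect_config n j c"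
      then have "reflect_config n j c' = c"
        using assms c by (simp add: reflect_reflect rotate_0)
      then show ?thesis
        using c j by (force simp: congruence_def)
    qed
  qed
  show "trans (congruence n)"
  proof (rule transI)
    fix c c' c'' assume "(c, c') \<in> congruence n" "(c', c'') \<in> congruence n"
    then obtain j k where "c \<in> configs n" "c'' \<in> configs n"
      and "c' = rotate_config n j c \<or> c' = reflect_config n j c"
      and "c'' = rotate_config n k c' \<or> c'' = reflect_config n k c'"
      by (auto simp: congruence_def)
    moreover from this(3,4) assms
    have "\<exists>i\<in>Zn n. c'' = rotate_config n i c \<or> c'' = reflect_config n i c"
      by (metis rotate_rotate rotate_reflect reflect_rotate reflect_reflect mod_in_Zn)
    ultimately show "(c, c'') \<in> congruence n"
      by (simp add: congruence_def)
  qed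
qed

end

theory Submission
  imports Defs
begin

text \<open>A configuration with minimal period \<open>p\<close> has period \<open>n div d\<close> exactly for the divisors \<open>d\<close> of
  \<open>n div p\<close>, and the Moebius function sums to zero over these unless \<open>p = n\<close>.  Hence minus the sum
  of \<open>moebius d\<close> over such \<open>d \<ge> 2\<close> is the indicator of rotational symmetry.  Summed over congruence
  classes, this leaves the number of classes with period \<open>n div d\<close>; they correspond to the classes
  on \<open>n div d\<close> points, with the number of ones divided by \<open>d\<close>.  Those are counted by Burnside's
  lemma.\<close>

section \<open>Moebius sums over periods\<close>

text \<open>The Moebius identity concerns single configurations, while the theorem counts classes,
  whose sizes vary with their symmetry. The weight 1 / (size of the class) bridges the two: the
  number of classes in a set closed under congruence is the sum of the weights of its members, so an
  identity that holds configuration by configuration can be multiplied by the weight and summed,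
  without choosing representatives. The same weights compare circles of different sizes, because
  repeating a configuration from \<open>n div d\<close> points around \<open>n\<close> points
  preserves the size of its class. The closed forms are Burnside averages that include the zero
  configuration: \<open>alpha_seq n\<close> counts all classes on \<open>n\<close> points and
  \<open>beta_seq n\<close> those with a diameter of symmetry. The reflections alone determine
  \<open>beta_seq n\<close>, and they contribute half of it to \<open>alpha_seq n\<close>; the
  totient sum comes from the rotations.\<close>

lemma moebius_prime_mult:
  assumes p: "prime p" and d: "\<not> p dvd d" "d > 0"
  shows "moebius (p * d) = - moebius d"
proof -
  have c: "coprime p d" using p d by (simp add: prime_imp_coprime)
  have sq: "squarefree (p * d) \<longleftrightarrow> squarefree d"
    using c p by (metis squarefree_mult_coprime squarefree_multD(2) squarefree_prime)
  have "prime_factors (p * d) = insert p (prime_factors d)"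
    using p d by (auto simp: prime_factors_product prime_prime_factors)
  moreover have "p \<notin> prime_factors d" using d by auto
  ultimately have "card (prime_factors (p * d)) = Suc (card (prime_factors d))" by simp
  then show ?thesis using sq by (simp add: moebius_def)
qed

text \<open>Fix a prime \<open>p\<close> dividing \<open>m\<close>. Only squarefree divisors
  contribute, and they fall into pairs \<open>d\<close>, \<open>p * d\<close> with \<open>d\<close>
  not divisible by \<open>p\<close>, whose terms cancel.\<close>

lemma sum_moebius_divisors:
  assumes "m > 0"
  shows "(\<Sum>d | d dvd m. moebius d) = (if m = 1 then 1 else 0)"
proof (cases "m = 1")
  case True
  then show ?thesis by (simp add: moebius_def)
next
  case False
  then obtain p where p: "prime p" "p dvd m" using prime_factor_nat by blast
  have fin: "finite {d. d dvd m}" using assms by simp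
  let ?D = "{d. d dvd m \<and> squarefree d}"
  let ?A = "{d \<in> ?D. \<not> p dvd d}"
  have finA: "finite ?A" by (rule finite_subset[OF _ fin]) auto
  have split: "?D = ?A \<union> (*) p ` ?A"
  proof (intro equalityI subsetI)
    fix d assume d: "d \<in> ?D"
    show "d \<in> ?A \<union> (*) p ` ?A"
    proof (cases "p dvd d")
      case True
      then obtain e where e: "d = p * e" by auto
      have "\<not> p dvd e"
      proof
        assume "p dvd e"
        then have "p ^ 2 dvd d" by (simp add: e power2_eq_square)
        then show False using d p by (auto simp: squarefree_def)
      qed
      then have "e \<in> ?A"
        using d e by (auto intro: squarefree_multD dvd_mult_right)
      then show ?thesis using e by blast
    qed (use d in auto)
  next
    fix d assume d: "d \<in> ?A \<union> (*) p ` ?A"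
    show "d \<in> ?D"
    proof (cases "d \<in> ?A")
      case False
      then obtain e where e: "d = p * e" "e \<in> ?A" using d by auto
      then have c: "coprime p e" using p by (simp add: prime_imp_coprime)
      then show ?thesis using e p
        by (simp add: squarefree_mult_coprime squarefree_prime divides_mult)
    qed (use d in auto)
  qed
  have "(\<Sum>d | d dvd m. moebius d) = sum moebius ?D"
    using fin by (intro sum.mono_neutral_right) (auto simp: moebius_def)
  also have "\<dots> = sum moebius ?A + sum moebius ((*) p ` ?A)"
    by (subst split, rule sum.union_disjoint) (use finA in auto)
  also have "sum moebius ((*) p ` ?A) = (\<Sum>d\<in>?A. moebius (p * d))"
    using p by (subst sum.reindex) (auto simp: inj_on_def prime_gt_0_nat)
  also have "\<dots> = (\<Sum>d\<in>?A. - moebius d)"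
    using p assms by (intro sum.cong refl moebius_prime_mult) (auto intro: dvd_pos_nat)
  finally show ?thesis using False by (simp add: sum_negf)
qed

section \<open>Periods of a configuration\<close>

lemma int_mod_mult_mod: "m dvd n \<Longrightarrow> (i mod int n) mod int m = i mod int m"
  by (simp add: mod_mod_cancel)

text \<open>Every configuration is viewed below as the function \<open>i \<mapsto> c (i mod n)\<close> on all integers,
  so that its periods form a subgroup of the integers.\<close>

lemma rotate_config_eq_iff:
  assumes "c \<in> configs n" "n > 0"
  shows "rotate_config n j c = c \<longleftrightarrow> (\<forall>i. c ((i + j) mod int n) = c (i mod int n))"
    (is "?L \<longleftrightarrow> ?R")
proof
  assume L: ?L
  show ?R
  proof
    fix i
    have "rotate_config n j c (i mod int n) = c (i mod int n)" using L by simp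
    then show "c ((i + j) mod int n) = c (i mod int n)"
      using mod_in_Zn[OF assms(2), of i] by (simp add: rotate_config_def mod_simps)
  qed
next
  assume R: ?R
  show ?L
  proof
    fix i show "rotate_config n j c i = c i"
      using R[rule_format, of i] assms
      by (cases "i \<in> Zn n") (auto simp: rotate_config_def configs_def PiE_def extensional_def)
  qed
qed

lemma reflect_config_eq_iff:
  assumes "c \<in> configs n"
  shows "reflect_config n j c = c \<longleftrightarrow> (\<forall>i\<in>Zn n. c ((j - i) mod int n) = c i)"
  using assms by (auto simp: reflect_config_def configs_def PiE_def extensional_def fun_eq_iff)

lemma rotate_config_mod: "rotate_config n (j mod int n) c = rotate_config n j c"
  by (simp add: rotate_config_def mod_simps)

lemma reflect_config_mod: "reflect_config n (j mod int n) c = reflect_config n j c"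
  by (simp add: reflect_config_def mod_simps)

lemma dihedral_in_configs:
  assumes "c \<in> configs n" "n > 0"
  shows "rotate_config n j c \<in> configs n" "reflect_config n j c \<in> configs n"
  using assms mod_in_Zn[OF assms(2)] PiE_mem[of c "Zn n" "\<lambda>_. {0, 1}"]
  unfolding configs_def rotate_config_def reflect_config_def restrict_PiE_iff by blast+

lemma rotation_symmetric_iff:
  assumes "c \<in> configs n" "n > 0"
  shows "rotation_symmetric n c \<longleftrightarrow> (\<exists>j. 0 < j \<and> j < int n \<and> rotate_config n j c = c)"
proof -
  have "rotate_config n j c = c \<longleftrightarrow> (\<forall>i\<in>Zn n. c ((i + j) mod int n) = c i)" for j
    using assms by (auto simp: rotate_config_def configs_def PiE_def extensional_def fun_eq_iff)
  then show ?thesis by (simp add: rotation_symmetric_def)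
qed

lemma has_symmetry_diameter_iff:
  assumes "c \<in> configs n"
  shows "has_symmetry_diameter n c \<longleftrightarrow> (\<exists>j\<in>Zn n. reflect_config n j c = c)"
  using assms by (simp add: has_symmetry_diameter_def reflect_config_eq_iff)

lemma finite_Zn [simp]: "finite (Zn n)" and card_Zn [simp]: "card (Zn n) = n"
  by (simp_all add: Zn_def)

lemma finite_configs [simp]: "finite (configs n)"
  by (simp add: configs_def finite_PiE)

lemma rotate_config_period_add:
  assumes "c \<in> configs n" "n > 0" "rotate_config n j c = c" "rotate_config n k c = c"
  shows "rotate_config n (j + k) c = c"
  using rotate_rotate[OF assms(2), of j k c] assms(3,4) by (simp add: rotate_config_mod)

lemma rotate_config_period_uminus:
  assumes "c \<in> configs n" "n > 0" "rotate_config n j c = c"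
  shows "rotate_config n (- j) c = c"
  using rotate_rotate[OF assms(2), of "- j" j c] assms rotate_0[of c n]
  by simp

lemma rotate_config_period_mult:
  assumes "c \<in> configs n" "n > 0" "rotate_config n j c = c"
  shows "rotate_config n (j * k) c = c"
proof (induction k rule: int_induct[where k = 0])
  case base show ?case using assms rotate_0 by simp
next
  case (step1 i)
  then show ?case using rotate_config_period_add[OF assms(1,2) step1(2) assms(3)]
    by (simp add: algebra_simps)
next
  case (step2 i)
  then show ?case using rotate_config_period_add[OF assms(1,2) step2(2) rotate_config_period_uminus[OF assms]]
    by (simp add: algebra_simps)
qed

lemma rotate_config_period_self:
  assumes "c \<in> configs n" "n > 0"
  shows "rotate_config n (int n) c = c"
  using rotate_config_mod[of n "int n" c] rotate_0[OF assms(1)] by simp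

text \<open>Bezout writes the gcd as a combination of the periods \<open>j\<close> and
  \<open>n\<close>; conversely \<open>j\<close> is a multiple of the gcd. Later this groups the
  rotations by the gcd of their index with \<open>n\<close>.\<close>

lemma rotate_config_gcd:
  assumes "c \<in> configs n" "n > 0"
  shows "rotate_config n j c = c \<longleftrightarrow> rotate_config n (gcd j (int n)) c = c"
proof
  assume j: "rotate_config n j c = c"
  obtain u v where uv: "u * j + v * int n = gcd j (int n)" using bezout_int by blast
  have "rotate_config n (j * u + int n * v) c = c"
    using assms j by (intro rotate_config_period_add rotate_config_period_mult rotate_config_period_self)
  then show "rotate_config n (gcd j (int n)) c = c" using uv by (simp add: mult.commute)
next
  assume g: "rotate_config n (gcd j (int n)) c = c"
  obtain q where "j = gcd j (int n) * q" by (meson dvd_def gcd_dvd1)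
  then show "rotate_config n j c = c" using rotate_config_period_mult[OF assms g, of q] by simp
qed

text \<open>The periods form a subgroup of the integers, and \<open>p\<close> is its positive
  generator. It divides \<open>n\<close> because \<open>n\<close> itself is a period.\<close>

lemma minimal_period:
  assumes "c \<in> configs n" "n > 0"
  obtains p where "p > 0" "p dvd n" "\<And>j. rotate_config n j c = c \<longleftrightarrow> int p dvd j"
proof -
  define p where "p = (LEAST p. 0 < p \<and> rotate_config n (int p) c = c)"
  have p: "0 < p \<and> rotate_config n (int p) c = c"
    unfolding p_def by (rule LeastI[of _ n]) (use assms rotate_config_period_self in auto)
  have min: "q = 0" if "q < p" "rotate_config n (int q) c = c" for q
    using not_less_Least[of q "\<lambda>p. 0 < p \<and> rotate_config n (int p) c = c"] that
    by (auto simp: p_def)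
  have iff: "rotate_config n j c = c \<longleftrightarrow> int p dvd j" for j
  proof
    assume j: "rotate_config n j c = c"
    \<comment> \<open>The remainder of \<open>j\<close> modulo \<open>p\<close> is again a period,
      so minimality of \<open>p\<close> forces it to be 0.\<close>
    have "rotate_config n (j + int p * (- (j div int p))) c = c"
      using assms j p by (intro rotate_config_period_add rotate_config_period_mult) auto
    also have "j + int p * (- (j div int p)) = int (nat (j mod int p))"
      using p by (simp add: minus_mult_div_eq_mod)
    finally have "nat (j mod int p) = 0"
      using p by (intro min) (auto simp: nat_less_iff)
    then show "int p dvd j" using p
      by (metis int_nat_eq mod_0_imp_dvd of_nat_0 of_nat_0_less_iff pos_mod_sign)
  next
    assume "int p dvd j"
    then show "rotate_config n j c = c" using rotate_config_period_mult[OF assms] p by auto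
  qed
  then have "p dvd n" using rotate_config_period_self[OF assms] by simp
  then show ?thesis using that p iff by blast
qed

lemma rotation_symmetric_moebius:
  assumes "c \<in> configs n" "n > 0"
  shows "(\<Sum>d | d dvd n \<and> d \<ge> 2 \<and> rotate_config n (int (n div d)) c = c. moebius d)
       = (if rotation_symmetric n c then - 1 else 0)"
proof -
  obtain p where p: "p > 0" "p dvd n" and iff: "\<And>j. rotate_config n j c = c \<longleftrightarrow> int p dvd j"
    using minimal_period[OF assms] by blast
  define m where "m = n div p"
  have m: "n = p * m" "m > 0" using p assms by (auto simp: m_def dvd_div_eq_0_iff)
  have eq: "{d. d dvd n \<and> rotate_config n (int (n div d)) c = c} = {d. d dvd m}"
  proof (intro Collect_cong iffI conjI)
    fix d assume d: "d dvd n \<and> rotate_config n (int (n div d)) c = c"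
    then have "p dvd n div d" by (simp add: iff)
    then obtain k where "n div d = p * k" by auto
    then have "p * m = p * (k * d)" using d m(1) by (metis dvd_div_mult_self mult.assoc)
    then show "d dvd m" using p by simp
  next
    fix d assume d: "d dvd m"
    then show "d dvd n" by (simp add: m)
    have "n div d = p * (m div d)" using d m by (simp add: div_mult_swap)
    then show "rotate_config n (int (n div d)) c = c" by (simp add: iff)
  qed
  have "rotation_symmetric n c \<longleftrightarrow> m \<noteq> 1"
  proof -
    have "rotation_symmetric n c \<longleftrightarrow> (\<exists>j. 0 < j \<and> j < int n \<and> int p dvd j)"
      using assms by (simp add: rotation_symmetric_iff iff)
    also have "\<dots> \<longleftrightarrow> p < n"
      using p(1) by (auto dest: zdvd_imp_le intro!: exI[of _ "int p"])
    also have "\<dots> \<longleftrightarrow> m \<noteq> 1" using m p by auto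
    finally show ?thesis .
  qed
  \<comment> \<open>The restriction to \<open>d\<close> at least 2 deletes exactly the term for
    \<open>d = 1\<close>, whose value is 1. The full sum, 0 for \<open>m\<close> other than 1 and 1
    for \<open>m = 1\<close>, thus becomes -1 or 0.\<close>
  moreover have "{d. d dvd n \<and> d \<ge> 2 \<and> rotate_config n (int (n div d)) c = c} = {d. d dvd m} - {1}"
  proof -
    have "d \<ge> 2 \<longleftrightarrow> d \<noteq> 1" if "d dvd m" for d
      using dvd_pos_nat[OF m(2) that] by auto
    then show ?thesis using eq by (auto simp: set_eq_iff)
  qed
  ultimately show ?thesis
    using m sum_moebius_divisors[OF m(2)] by (simp add: sum_diff1 moebius_def)
qed

section \<open>Orbits of the dihedral group\<close>

lemma bij_betw_Zn_shift:
  assumes "n > 0"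
  shows "bij_betw (\<lambda>i. (i + k) mod int n) (Zn n) (Zn n)"
  by (rule bij_betwI[where g = "\<lambda>i. (i - k) mod int n"])
    (use assms in \<open>auto simp: mod_in_Zn mod_simps\<close>)

lemma bij_betw_Zn_reflect:
  assumes "n > 0"
  shows "bij_betw (\<lambda>i. (k - i) mod int n) (Zn n) (Zn n)"
  by (rule bij_betwI[where g = "\<lambda>i. (k - i) mod int n"])
    (use assms in \<open>auto simp: mod_in_Zn mod_simps\<close>)

lemma card_Collect_bij:
  assumes "bij_betw f A B"
  shows "card {x \<in> A. P (f x)} = card {y \<in> B. P y}"
proof (rule bij_betw_same_card)
  show "bij_betw f {x \<in> A. P (f x)} {y \<in> B. P y}"
    using assms by (auto simp: bij_betw_def inj_on_def)
qed

lemma congruence_iff: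
  assumes "n > 0"
  shows "(c, c') \<in> congruence n \<longleftrightarrow>
    c \<in> configs n \<and> (\<exists>j. c' = rotate_config n j c \<or> c' = reflect_config n j c)"
proof
  assume R: "c \<in> configs n \<and> (\<exists>j. c' = rotate_config n j c \<or> c' = reflect_config n j c)"
  then obtain j where "c' = rotate_config n (j mod int n) c \<or> c' = reflect_config n (j mod int n) c"
    by (auto simp: rotate_config_mod reflect_config_mod)
  then show "(c, c') \<in> congruence n"
    using R assms dihedral_in_configs mod_in_Zn[OF assms, of j] by (auto simp: congruence_def)
qed (auto simp: congruence_def)

lemma congruence_cases [consumes 2, case_names rotate reflect]:
  assumes "n > 0" "(c, c') \<in> congruence n"
  obtains j where "c \<in> configs n" "c' = rotate_config n j c"
    | j where "c \<in> configs n" "c' = reflect_config n j c"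
  using assms by (auto simp: congruence_iff)

lemma rotate_rotate': "n > 0 \<Longrightarrow> rotate_config n j (rotate_config n k c) = rotate_config n (j + k) c"
  by (simp add: rotate_rotate rotate_config_mod)

lemma rotate_reflect': "n > 0 \<Longrightarrow> rotate_config n j (reflect_config n k c) = reflect_config n (k - j) c"
  by (simp add: rotate_reflect reflect_config_mod)

lemma reflect_rotate': "n > 0 \<Longrightarrow> reflect_config n j (rotate_config n k c) = reflect_config n (j + k) c"
  by (simp add: reflect_rotate reflect_config_mod)

lemma reflect_reflect': "n > 0 \<Longrightarrow> reflect_config n j (reflect_config n k c) = rotate_config n (k - j) c"
  by (simp add: reflect_reflect rotate_config_mod)

lemmas dihedral_comp = rotate_rotate' rotate_reflect' reflect_rotate' reflect_reflect'

lemma rotate_config_eq_move: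
  assumes "c \<in> configs n" "c' \<in> configs n" "n > 0"
  shows "c' = rotate_config n k c \<longleftrightarrow> rotate_config n (- k) c' = c"
    "c' = reflect_config n k c \<longleftrightarrow> reflect_config n k c' = c"
  using assms by (auto simp: dihedral_comp rotate_0)

text \<open>The symmetries taking \<open>c\<close> to \<open>c'\<close> form a coset of the
  stabilizer of \<open>c\<close>. When \<open>c'\<close> is a reflected copy, rotations and
  reflections change places, so in general only the sum of the two counts is preserved.\<close>

lemma card_transporter:
  assumes "n > 0" "(c, c') \<in> congruence n"
  shows "card {j \<in> Zn n. rotate_config n j c = c'} + card {j \<in> Zn n. reflect_config n j c = c'}
       = card {j \<in> Zn n. rotate_config n j c = c} + card {j \<in> Zn n. reflect_config n j c = c}"
  using assms
proof (cases rule: congruence_cases)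
  case (rotate k)
  have "{j \<in> Zn n. rotate_config n j c = c'} = {j \<in> Zn n. rotate_config n ((j + (- k)) mod int n) c = c}"
    using rotate assms(1) dihedral_in_configs[OF rotate(1) assms(1)]
    by (simp add: rotate_config_mod rotate_config_eq_move(1)[of c n "rotate_config n _ c"] dihedral_comp)
  moreover have "{j \<in> Zn n. reflect_config n j c = c'} = {j \<in> Zn n. reflect_config n ((j + k) mod int n) c = c}"
    using rotate assms(1) dihedral_in_configs[OF rotate(1) assms(1)]
    by (simp add: reflect_config_mod rotate_config_eq_move(1)[of c n "reflect_config n _ c"] dihedral_comp)
  ultimately show ?thesis
    using card_Collect_bij[OF bij_betw_Zn_shift[OF assms(1)], of "\<lambda>j. rotate_config n j c = c"]
      card_Collect_bij[OF bij_betw_Zn_shift[OF assms(1)], of "\<lambda>j. reflect_config n j c = c"]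
    by (simp only:)
next
  case (reflect k)
  have "{j \<in> Zn n. reflect_config n j c = c'} = {j \<in> Zn n. rotate_config n ((j + (- k)) mod int n) c = c}"
    using reflect assms(1) dihedral_in_configs[OF reflect(1) assms(1)]
    by (simp add: rotate_config_mod rotate_config_eq_move(2)[of c n "reflect_config n _ c"] dihedral_comp)
  moreover have "{j \<in> Zn n. rotate_config n j c = c'} = {j \<in> Zn n. reflect_config n ((j + k) mod int n) c = c}"
    using reflect assms(1) dihedral_in_configs[OF reflect(1) assms(1)]
    by (simp add: reflect_config_mod rotate_config_eq_move(2)[of c n "rotate_config n _ c"] dihedral_comp
        add.commute)
  ultimately show ?thesis
    using card_Collect_bij[OF bij_betw_Zn_shift[OF assms(1)], of "\<lambda>j. rotate_config n j c = c"]
      card_Collect_bij[OF bij_betw_Zn_shift[OF assms(1)], of "\<lambda>j. reflect_config n j c = c"]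
    by (simp only:)
qed

section \<open>Orbit-stabilizer and Burnside's lemma\<close>

lemma congruence_class_subset:
  assumes "n > 0"
  shows "congruence n `` A \<subseteq> configs n"
  using equiv_congruence[OF assms] by (auto simp: equiv_def)

text \<open>Orbit-stabilizer: sorting all symmetries by the image of \<open>c\<close> gives groups
  of equal size by \<open>card_transporter\<close>. Symmetries are counted by kind and index, not as
  maps, so the total is \<open>2 * n\<close> even for \<open>n = 1\<close> and \<open>n = 2\<close>,
  where rotations and reflections coincide as maps.\<close>

lemma card_congruence_class:
  assumes "n > 0" "c \<in> configs n"
  shows "card (congruence n `` {c}) *
      (card {j \<in> Zn n. rotate_config n j c = c} + card {j \<in> Zn n. reflect_config n j c = c}) = 2 * n"
proof -
  let ?C = "congruence n `` {c}"
  have fin: "finite ?C"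
    using congruence_class_subset[OF assms(1)] finite_configs by (rule finite_subset)
  have grp: "(\<Sum>c'\<in>?C. card {j \<in> Zn n. f j = c'}) = n" if "f ` Zn n \<subseteq> ?C" for f
    using sum.group[OF finite_Zn fin that, of "\<lambda>_. 1::nat"] by simp
  have "2 * n = (\<Sum>c'\<in>?C. card {j \<in> Zn n. rotate_config n j c = c'} + card {j \<in> Zn n. reflect_config n j c = c'})"
    unfolding sum.distrib using assms
    by (subst grp, force simp: congruence_iff, subst grp, force simp: congruence_iff, simp)
  also have "\<dots> = (\<Sum>c'\<in>?C. card {j \<in> Zn n. rotate_config n j c = c} + card {j \<in> Zn n. reflect_config n j c = c})"
    using card_transporter[OF assms(1), of c] by (intro sum.cong) auto
  finally show ?thesis by simp
qed

text \<open>Each class contributes its size times the reciprocal of its size, since closure of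
  \<open>Y\<close> puts the whole class into the sum.\<close>

lemma card_quotient_eq_sum:
  assumes "equiv A r" "finite A" "Y \<subseteq> A" "r `` Y \<subseteq> Y"
  shows "of_nat (card (Y // r)) = (\<Sum>c\<in>Y. 1 / of_nat (card (r `` {c})) :: rat)"
proof -
  have fin: "finite Y" using assms finite_subset by blast
  have Q: "Y // r = (\<lambda>c. r `` {c}) ` Y" by (auto simp: quotient_def)
  have "(\<Sum>c\<in>Y. 1 / of_nat (card (r `` {c})) :: rat)
      = (\<Sum>C\<in>Y // r. \<Sum>c\<in>{c \<in> Y. r `` {c} = C}. 1 / of_nat (card (r `` {c})))"
    unfolding Q by (rule sum.group[symmetric]) (use fin in auto)
  also have "\<dots> = (\<Sum>C\<in>Y // r. 1)"
  proof (rule sum.cong)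
    fix C assume "C \<in> Y // r"
    then obtain y where y: "y \<in> Y" "C = r `` {y}" by (auto simp: Q)
    have C: "{c \<in> Y. r `` {c} = C} = C"
    proof (intro equalityI subsetI)
      fix c assume "c \<in> {c \<in> Y. r `` {c} = C}"
      then show "c \<in> C" using equiv_class_self[OF assms(1), of c] assms(3) by auto
    next
      fix c assume c: "c \<in> C"
      then have "r `` {y} = r `` {c}" using equiv_class_eq[OF assms(1), of y c] y by simp
      then show "c \<in> {c \<in> Y. r `` {c} = C}" using c y assms(4) by auto
    qed
    have "C \<noteq> {}" "finite C"
      using y assms equiv_class_self[OF assms(1), of y] fin finite_subset[of C Y] by auto
    have "(\<Sum>c\<in>{c \<in> Y. r `` {c} = C}. 1 / of_nat (card (r `` {c})) :: rat)
        = (\<Sum>c\<in>{c \<in> Y. r `` {c} = C}. 1 / of_nat (card C))"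
      by (rule sum.cong) auto
    also have "\<dots> = 1" unfolding C using \<open>C \<noteq> {}\<close> \<open>finite C\<close> by simp
    finally show "(\<Sum>c\<in>{c \<in> Y. r `` {c} = C}. 1 / of_nat (card (r `` {c})) :: rat) = 1" .
  qed simp
  finally show ?thesis by simp
qed

lemma card_congruence_quotient:
  assumes "n > 0" "Y \<subseteq> configs n" "congruence n `` Y \<subseteq> Y"
  shows "of_nat (card (Y // congruence n)) = (\<Sum>c\<in>Y. 1 / of_nat (card (congruence n `` {c})) :: rat)"
  using assms by (intro card_quotient_eq_sum[OF equiv_congruence]) auto

lemma sum_card_Collect_swap:
  assumes "finite A" "finite B"
  shows "(\<Sum>x\<in>A. card {y \<in> B. P x y}) = (\<Sum>y\<in>B. card {x \<in> A. P x y})"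
  using sum.swap[of "\<lambda>x y. of_bool (P x y) :: nat" B A] assms
  by (simp add: sum.If_cases Int_def of_bool_def)

text \<open>By orbit-stabilizer, \<open>2 * n\<close> times the weight of a configuration is the
  number of symmetries fixing it; double counting then gives the configurations fixed by each
  symmetry.\<close>

lemma burnside_congruence:
  assumes "n > 0" "Y \<subseteq> configs n" "congruence n `` Y \<subseteq> Y"
  shows "2 * n * card (Y // congruence n) =
    (\<Sum>j\<in>Zn n. card {c \<in> Y. rotate_config n j c = c}) + (\<Sum>j\<in>Zn n. card {c \<in> Y. reflect_config n j c = c})"
proof -
  let ?S = "\<lambda>c. card {j \<in> Zn n. rotate_config n j c = c} + card {j \<in> Zn n. reflect_config n j c = c}"
  have fin: "finite Y" using assms finite_configs finite_subset by blast
  have "of_nat (2 * n) * of_nat (card (Y // congruence n)) = (\<Sum>c\<in>Y. of_nat (?S c) :: rat)"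
    unfolding card_congruence_quotient[OF assms] sum_distrib_left
  proof (rule sum.cong)
    fix c assume "c \<in> Y"
    then have *: "card (congruence n `` {c}) * ?S c = 2 * n"
      using assms by (intro card_congruence_class) auto
    have "card (congruence n `` {c}) > 0"
    proof (rule gr0I)
      assume "card (congruence n `` {c}) = 0"
      with * have "0 * ?S c = 2 * n" by (rule subst[where P = "\<lambda>x. x * ?S c = 2 * n", rotated])
      then show False using assms(1) by (simp only: mult_0)
    qed
    moreover have "of_nat (2 * n) = of_nat (card (congruence n `` {c})) * (of_nat (?S c) :: rat)"
      by (simp only: *[symmetric] of_nat_mult)
    ultimately show "of_nat (2 * n) * (1 / of_nat (card (congruence n `` {c}))) = (of_nat (?S c) :: rat)"
      by (simp only: times_divide_eq_right mult_1_right) (simp del: of_nat_add)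
  qed simp
  also have "\<dots> = of_nat (\<Sum>c\<in>Y. ?S c)" by (simp only: of_nat_sum)
  finally have "2 * n * card (Y // congruence n) = (\<Sum>c\<in>Y. ?S c)"
    by (simp only: of_nat_mult[symmetric] of_nat_eq_iff)
  then show ?thesis
    unfolding sum.distrib sum_card_Collect_swap[OF fin finite_Zn] .
qed

section \<open>Invariants of congruence\<close>

lemma rotate_invariant_congruent:
  assumes "n > 0" "(c, c') \<in> congruence n" "rotate_config n j c = c"
  shows "rotate_config n j c' = c'"
  using assms(1,2)
proof (cases rule: congruence_cases)
  case (rotate k)
  have "rotate_config n j c' = rotate_config n k (rotate_config n j c)"
    using rotate assms(1) by (simp add: rotate_rotate' add.commute)
  then show ?thesis using assms(3) rotate by simp
next
  case (reflect k)
  \<comment> \<open>A reflection conjugates the rotation by \<open>j\<close> into the rotation by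
    \<open>- j\<close>, which also fixes \<open>c\<close>.\<close>
  have "rotate_config n j c' = reflect_config n k (rotate_config n (- j) c)"
    using reflect(2) assms(1) by (simp add: dihedral_comp)
  then show ?thesis
    using rotate_config_period_uminus[OF reflect(1) assms(1,3)] reflect(2) by simp
qed

text \<open>Conjugation moves the axis, so the existence of a fixing reflection passes to congruent
  configurations, but its index need not.\<close>

lemma reflect_invariant_congruent:
  assumes "n > 0" "(c, c') \<in> congruence n" "\<exists>j. reflect_config n j c = c"
  shows "\<exists>j. reflect_config n j c' = c'"
proof -
  obtain j where j: "reflect_config n j c = c" using assms by blast
  show ?thesis using assms(1,2)
  proof (cases rule: congruence_cases)
    case (rotate k)
    \<comment> \<open>Both sides are the reflection of \<open>c\<close> with index
      \<open>j - k\<close>; this dictates the new index.\<close>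
    have "reflect_config n (j - 2 * k) c' = rotate_config n k (reflect_config n j c)"
      using rotate assms(1) by (simp add: dihedral_comp)
    then show ?thesis using j rotate by auto
  next
    case (reflect k)
    have "reflect_config n (2 * k - j) c' = reflect_config n k (reflect_config n j c)"
      using reflect assms(1) by (simp add: dihedral_comp)
    then show ?thesis using j reflect by auto
  qed
qed

lemma rotation_symmetric_congruent:
  assumes "n > 0" "(c, c') \<in> congruence n" "rotation_symmetric n c"
  shows "rotation_symmetric n c'"
proof -
  have "c \<in> configs n" "c' \<in> configs n" using assms(2) by (auto simp: congruence_def)
  then show ?thesis
    using assms rotate_invariant_congruent by (auto simp: rotation_symmetric_iff)
qed

lemma has_symmetry_diameter_iff':
  assumes "c \<in> configs n" "n > 0"
  shows "has_symmetry_diameter n c \<longleftrightarrow> (\<exists>j. reflect_config n j c = c)"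
  unfolding has_symmetry_diameter_iff[OF assms(1)]
  using mod_in_Zn[OF assms(2)] by (metis reflect_config_mod)

lemma has_symmetry_diameter_congruent:
  assumes "n > 0" "(c, c') \<in> congruence n" "has_symmetry_diameter n c"
  shows "has_symmetry_diameter n c'"
proof -
  have "c \<in> configs n" "c' \<in> configs n" using assms(2) by (auto simp: congruence_def)
  then show ?thesis
    using assms reflect_invariant_congruent by (simp add: has_symmetry_diameter_iff')
qed

lemma card_ones_congruent:
  assumes "n > 0" "(c, c') \<in> congruence n"
  shows "card (ones n c') = card (ones n c)"
  using assms
proof (cases rule: congruence_cases)
  case (rotate j)
  have "ones n c' = {i \<in> Zn n. c ((i + j) mod int n) = 1}"
    by (auto simp: ones_def rotate rotate_config_def)
  then show ?thesis
    using card_Collect_bij[OF bij_betw_Zn_shift[OF assms(1)], of "\<lambda>i. c i = 1"] by (simp add: ones_def)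
next
  case (reflect j)
  have "ones n c' = {i \<in> Zn n. c ((j - i) mod int n) = 1}"
    by (auto simp: ones_def reflect reflect_config_def)
  then show ?thesis
    using card_Collect_bij[OF bij_betw_Zn_reflect[OF assms(1)], of "\<lambda>i. c i = 1"] by (simp add: ones_def)
qed

text \<open>Leaving \<open>Y\<close> general lets one argument serve all configurations, those with
  a diameter, and those with a given number of ones. After the sums over \<open>d\<close> and
  \<open>c\<close> are exchanged, the inner sum is the Moebius sum over the periods of a single
  configuration.\<close>

lemma card_rotation_symmetric_classes:
  assumes "n > 0" "Y \<subseteq> configs n" "congruence n `` Y \<subseteq> Y"
  shows "of_nat (card ({c \<in> Y. rotation_symmetric n c} // congruence n)) =
    - (\<Sum>d | d dvd n \<and> d \<ge> 2. of_int (moebius d) *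
        of_nat (card ({c \<in> Y. rotate_config n (int (n div d)) c = c} // congruence n)) :: rat)"
proof -
  let ?w = "\<lambda>c. 1 / of_nat (card (congruence n `` {c})) :: rat"
  let ?D = "{d. d dvd n \<and> d \<ge> 2}"
  have fin: "finite Y" using assms finite_configs finite_subset by blast
  have finD: "finite ?D" by (rule finite_subset[of _ "{d. d dvd n}"]) (use assms in auto)
  have closed: "congruence n `` {c \<in> Y. rotate_config n j c = c} \<subseteq> {c \<in> Y. rotate_config n j c = c}" for j
    using assms rotate_invariant_congruent by fastforce
  have "(\<Sum>d\<in>?D. of_int (moebius d) *
        of_nat (card ({c \<in> Y. rotate_config n (int (n div d)) c = c} // congruence n)) :: rat)
    = (\<Sum>d\<in>?D. \<Sum>c\<in>Y. if rotate_config n (int (n div d)) c = c then of_int (moebius d) * ?w c else 0)"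
    using assms fin closed
    by (intro sum.cong refl) (subst card_congruence_quotient, auto simp: sum_distrib_left sum.inter_filter intro!: sum.cong)
  also have "\<dots> = (\<Sum>c\<in>Y. \<Sum>d\<in>?D. if rotate_config n (int (n div d)) c = c then of_int (moebius d) * ?w c else 0)"
    by (rule sum.swap)
  also have "\<dots> = (\<Sum>c\<in>Y. if rotation_symmetric n c then - ?w c else 0)"
  proof (rule sum.cong)
    fix c assume "c \<in> Y"
    then have c: "c \<in> configs n" using assms by blast
    have "(\<Sum>d\<in>?D. if rotate_config n (int (n div d)) c = c then of_int (moebius d) * ?w c else 0)
      = (\<Sum>d | d dvd n \<and> d \<ge> 2 \<and> rotate_config n (int (n div d)) c = c. of_int (moebius d) * ?w c)"
      using finD by (simp add: sum.inter_filter[symmetric])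
    also have "\<dots> = of_int (\<Sum>d | d dvd n \<and> d \<ge> 2 \<and> rotate_config n (int (n div d)) c = c. moebius d) * ?w c"
      by (simp only: sum_distrib_right of_int_sum)
    also have "\<dots> = (if rotation_symmetric n c then - ?w c else 0)"
      unfolding rotation_symmetric_moebius[OF c assms(1)] by simp
    finally show "(\<Sum>d\<in>?D. if rotate_config n (int (n div d)) c = c then of_int (moebius d) * ?w c else 0)
      = (if rotation_symmetric n c then - ?w c else 0)" .
  qed simp
  also have "\<dots> = - of_nat (card ({c \<in> Y. rotation_symmetric n c} // congruence n))"
    using assms fin rotation_symmetric_congruent
    by (subst card_congruence_quotient) (auto simp: sum.inter_filter[symmetric] sum_negf)
  finally show ?thesis by simp
qed

section \<open>Periodic configurations as configurations on fewer points\<close>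

text \<open>For \<open>m dvd n\<close> this is the pullback along the homomorphism from Z_n onto
  Z_m, and hence it commutes with the rotation and the reflection of any index
  \<open>j\<close>.\<close>

definition expand_config :: "nat \<Rightarrow> nat \<Rightarrow> (int \<Rightarrow> nat) \<Rightarrow> int \<Rightarrow> nat" where
  "expand_config m n c = (\<lambda>i\<in>Zn n. c (i mod int m))"

lemma expand_config_mod:
  assumes "m dvd n" "n > 0"
  shows "expand_config m n c (i mod int n) = c (i mod int m)"
  using assms mod_in_Zn[OF assms(2), of i] by (simp add: expand_config_def int_mod_mult_mod)

lemma expand_rotate_config:
  assumes "m dvd n" "n > 0"
  shows "expand_config m n (rotate_config m j c) = rotate_config n j (expand_config m n c)"
proof -
  have "m > 0" using assms dvd_pos_nat by blast
  then show ?thesis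
    using expand_config_mod[OF assms, of c] mod_in_Zn[of m]
    by (auto simp: rotate_config_def fun_eq_iff) (auto simp: expand_config_def mod_simps)
qed

lemma expand_reflect_config:
  assumes "m dvd n" "n > 0"
  shows "expand_config m n (reflect_config m j c) = reflect_config n j (expand_config m n c)"
proof -
  have "m > 0" using assms dvd_pos_nat by blast
  then show ?thesis
    using expand_config_mod[OF assms, of c] mod_in_Zn[of m]
    by (auto simp: reflect_config_def fun_eq_iff) (auto simp: expand_config_def mod_simps)
qed

lemma expand_config_in_configs:
  assumes "m dvd n" "n > 0" "c \<in> configs m"
  shows "expand_config m n c \<in> configs n"
proof -
  have "m > 0" using assms dvd_pos_nat by blast
  then have "c (i mod int m) \<in> {0, 1}" for i
    using assms(3) mod_in_Zn[of m i] unfolding configs_def by (meson PiE_mem)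
  then show ?thesis unfolding configs_def expand_config_def restrict_PiE_iff by blast
qed

lemma inj_on_expand_config:
  assumes "m dvd n" "n > 0"
  shows "inj_on (expand_config m n) (configs m)"
proof (rule inj_onI)
  fix c c' assume c: "c \<in> configs m" "c' \<in> configs m" and eq: "expand_config m n c = expand_config m n c'"
  show "c = c'"
  proof (rule PiE_ext)
    show "c \<in> Zn m \<rightarrow>\<^sub>E {0, 1}" "c' \<in> Zn m \<rightarrow>\<^sub>E {0, 1}" using c by (simp_all add: configs_def)
    fix i assume "i \<in> Zn m"
    then show "c i = c' i"
      using eq expand_config_mod[OF assms, of c i] expand_config_mod[OF assms, of c' i] by simp
  qed
qed

lemma image_expand_config:
  assumes "m dvd n" "n > 0"
  shows "expand_config m n ` configs m = {c \<in> configs n. rotate_config n (int m) c = c}"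
proof (intro equalityI subsetI)
  fix c assume "c \<in> expand_config m n ` configs m"
  then obtain b where b: "b \<in> configs m" "c = expand_config m n b" by blast
  have "rotate_config m (int m) b = b"
    using b assms dvd_pos_nat by (intro rotate_config_period_self) auto
  then show "c \<in> {c \<in> configs n. rotate_config n (int m) c = c}"
    using b assms by (simp add: expand_config_in_configs expand_rotate_config[symmetric])
next
  fix c assume c: "c \<in> {c \<in> configs n. rotate_config n (int m) c = c}"
  have m: "m > 0" "m \<le> n" using assms dvd_pos_nat dvd_imp_le by blast+
  have sub: "Zn m \<subseteq> Zn n" using m by (auto simp: Zn_def)
  have "restrict c (Zn m) \<in> configs m"
    using c sub by (auto simp: configs_def restrict_PiE_iff dest: PiE_mem)
  moreover have "expand_config m n (restrict c (Zn m)) = c"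
  proof
    fix i
    show "expand_config m n (restrict c (Zn m)) i = c i"
    proof (cases "i \<in> Zn n")
      case True
      \<comment> \<open>Shifting by a multiple of \<open>m\<close> carries \<open>i\<close> to its
        remainder modulo \<open>m\<close>, where the restriction of \<open>c\<close> is
        known.\<close>
      have "rotate_config n (int m * (- (i div int m))) c = c"
        using c assms by (intro rotate_config_period_mult) auto
      then have "c ((i + int m * (- (i div int m))) mod int n) = c (i mod int n)"
        using c assms by (subst (asm) rotate_config_eq_iff) auto
      then have "c (i mod int m) = c i"
        using True sub mod_in_Zn[OF m(1), of i] by (auto simp: minus_mult_div_eq_mod subset_iff)
      then show ?thesis using True mod_in_Zn[OF m(1), of i] by (simp add: expand_config_def)
    next
      case False
      then show ?thesis using c
        by (auto simp: expand_config_def configs_def PiE_def extensional_def)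
    qed
  qed
  ultimately show "c \<in> expand_config m n ` configs m" by (metis imageI)
qed

text \<open>Division with remainder by \<open>n div d\<close> splits a position into one of
  \<open>d\<close> blocks and a position in the original configuration.\<close>

lemma card_ones_expand_config:
  assumes "n > 0" "d dvd n"
  shows "card (ones n (expand_config (n div d) n c)) = d * card (ones (n div d) c)"
proof -
  define m where "m = n div d"
  have n: "n = m * d" "m > 0" "d > 0" using assms by (auto simp: m_def dvd_div_eq_0_iff intro: dvd_pos_nat)
  have "bij_betw (\<lambda>(q, i). i + int m * int q) ({..<d} \<times> ones m c) (ones n (expand_config m n c))"
  proof (rule bij_betwI[where g = "\<lambda>i. (nat (i div int m), i mod int m)"])
    show "(\<lambda>(q, i). i + int m * int q) \<in> {..<d} \<times> ones m c \<rightarrow> ones n (expand_config m n c)"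
    proof clarsimp
      fix q i assume q: "q < d" and i: "i \<in> ones m c"
      have "int m * int q + int m \<le> int m * int d"
        using mult_left_mono[of "int (Suc q)" "int d" "int m"] q by (simp add: algebra_simps)
      then show "i + int m * int q \<in> ones n (expand_config m n c)"
        using i n by (auto simp: ones_def expand_config_def Zn_def)
    qed
    show "(\<lambda>i. (nat (i div int m), i mod int m)) \<in> ones n (expand_config m n c) \<rightarrow> {..<d} \<times> ones m c"
    proof
      fix i assume i: "i \<in> ones n (expand_config m n c)"
      then have "0 \<le> i" "i < int d * int m" using n by (auto simp: ones_def Zn_def mult.commute)
      moreover have "i div int m * int m \<le> i"
        using n by (simp add: minus_mod_eq_div_mult[symmetric])
      ultimately have "i div int m * int m < int d * int m" by linarith
      then have "nat (i div int m) < d"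
        using n \<open>0 \<le> i\<close> by (simp add: nat_less_iff pos_imp_zdiv_nonneg_iff)
      then show "(nat (i div int m), i mod int m) \<in> {..<d} \<times> ones m c"
        using i n mod_in_Zn[OF n(2), of i] by (auto simp: ones_def expand_config_def split: if_splits)
    qed
  qed (use n in \<open>auto simp: ones_def Zn_def pos_imp_zdiv_nonneg_iff\<close>)
  then have "card (ones n (expand_config m n c)) = card ({..<d} \<times> ones m c)"
    by (simp add: bij_betw_same_card)
  then show ?thesis by (simp add: m_def card_cartesian_product)
qed

lemma congruence_class_eq:
  assumes "n > 0" "c \<in> configs n"
  shows "congruence n `` {c} = range (\<lambda>j. rotate_config n j c) \<union> range (\<lambda>j. reflect_config n j c)"
  using assms by (auto simp: congruence_iff)

lemma congruence_class_expand:
  assumes "m dvd n" "n > 0" "c \<in> configs m"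
  shows "congruence n `` {expand_config m n c} = expand_config m n ` (congruence m `` {c})"
proof -
  have "m > 0" using assms dvd_pos_nat by blast
  then show ?thesis
    using expand_config_in_configs[OF assms] assms
    by (simp add: congruence_class_eq image_Un image_image expand_rotate_config expand_reflect_config)
qed

text \<open>Expansion is injective and carries each class on \<open>m\<close> points onto a class on
  \<open>n\<close> points. Corresponding configurations therefore have equal weights, although the
  two dihedral groups may differ in order.\<close>

lemma card_quotient_expand:
  assumes "m dvd n" "n > 0" "Y \<subseteq> configs m" "congruence m `` Y \<subseteq> Y"
  shows "card ((expand_config m n ` Y) // congruence n) = card (Y // congruence m)"
proof -
  have m: "m > 0" using assms dvd_pos_nat by blast
  have inj: "inj_on (expand_config m n) Y"
    using inj_on_expand_config[OF assms(1,2)] assms(3) by (rule inj_on_subset)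
  have cl: "congruence n `` (expand_config m n ` Y) \<subseteq> expand_config m n ` Y"
  proof -
    have "congruence n `` {expand_config m n c} \<subseteq> expand_config m n ` Y" if "c \<in> Y" for c
      using that assms by (subst congruence_class_expand) auto
    then show ?thesis by blast
  qed
  have "of_nat (card ((expand_config m n ` Y) // congruence n))
      = (\<Sum>c\<in>Y. 1 / of_nat (card (congruence n `` {expand_config m n c})) :: rat)"
    using assms expand_config_in_configs cl
    by (subst card_congruence_quotient) (auto simp: sum.reindex[OF inj])
  also have "\<dots> = (\<Sum>c\<in>Y. 1 / of_nat (card (congruence m `` {c})))"
  proof (rule sum.cong)
    fix c assume c: "c \<in> Y"
    have "card (congruence n `` {expand_config m n c}) = card (congruence m `` {c})"
      using c assms congruence_class_subset[OF m]
      by (subst congruence_class_expand) (auto intro!: card_image inj_on_subset[OF inj_on_expand_config])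
    then show "1 / of_nat (card (congruence n `` {expand_config m n c})) = (1 / of_nat (card (congruence m `` {c})) :: rat)"
      by simp
  qed simp
  also have "\<dots> = of_nat (card (Y // congruence m))"
    using card_congruence_quotient[OF m assms(3,4)] by simp
  finally show ?thesis by simp
qed

text \<open>As expansion is injective and commutes with reflections, an index \<open>j\<close> works
  for one configuration exactly when it works for the other.\<close>

lemma has_symmetry_diameter_expand:
  assumes "m dvd n" "n > 0" "c \<in> configs m"
  shows "has_symmetry_diameter n (expand_config m n c) \<longleftrightarrow> has_symmetry_diameter m c"
proof -
  have m: "m > 0" using assms dvd_pos_nat by blast
  show ?thesis
    using assms m
    by (simp add: has_symmetry_diameter_iff' expand_config_in_configs expand_reflect_config[symmetric]
        inj_on_eq_iff[OF inj_on_expand_config[OF assms(1,2)] dihedral_in_configs(2)[OF assms(3) m] assms(3)])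
qed

text \<open>If one reflection fixes a configuration, composing with it turns the rotations that fix it into
  the reflections that fix it.  So only the reflections need to be counted for symmetric classes.\<close>

lemma card_rotations_eq_card_reflections:
  assumes "n > 0" "c \<in> configs n" "has_symmetry_diameter n c"
  shows "card {j \<in> Zn n. rotate_config n j c = c} = card {j \<in> Zn n. reflect_config n j c = c}"
proof -
  obtain k where k: "reflect_config n k c = c" using assms by (auto simp: has_symmetry_diameter_iff)
  have "reflect_config n ((k - j) mod int n) c = c \<longleftrightarrow> rotate_config n j c = c" for j
  proof -
    have "reflect_config n (k - j) c = rotate_config n j c"
      using rotate_reflect'[OF assms(1), of j k c] k by simp
    then show ?thesis by (simp add: reflect_config_mod)
  qed
  then show ?thesis
    using card_Collect_bij[OF bij_betw_Zn_reflect[OF assms(1)], of "\<lambda>j. reflect_config n j c = c" k] by simp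
qed

text \<open>In Burnside's lemma for the members with a diameter, the rotation sum equals the
  reflection sum, so the factor 2 cancels.\<close>

lemma card_symmetric_classes:
  assumes "n > 0" "Y \<subseteq> configs n" "congruence n `` Y \<subseteq> Y"
  shows "n * card ({c \<in> Y. has_symmetry_diameter n c} // congruence n)
    = (\<Sum>j\<in>Zn n. card {c \<in> Y. reflect_config n j c = c})"
proof -
  let ?Z = "{c \<in> Y. has_symmetry_diameter n c}"
  have Z: "?Z \<subseteq> configs n" "congruence n `` ?Z \<subseteq> ?Z"
    using assms has_symmetry_diameter_congruent by auto
  have fin: "finite ?Z" using Z(1) finite_configs finite_subset by blast
  have "(\<Sum>j\<in>Zn n. card {c \<in> ?Z. rotate_config n j c = c}) = (\<Sum>j\<in>Zn n. card {c \<in> ?Z. reflect_config n j c = c})"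
    unfolding sum_card_Collect_swap[OF finite_Zn fin]
    using assms by (intro sum.cong card_rotations_eq_card_reflections) auto
  \<comment> \<open>Being fixed by a reflection already implies having a diameter, so the reflection
    sums over \<open>?Z\<close> and over \<open>Y\<close> agree.\<close>
  moreover have "{c \<in> ?Z. reflect_config n j c = c} = {c \<in> Y. reflect_config n j c = c}" for j
    using assms(1,2) has_symmetry_diameter_iff'[of _ n] by blast
  ultimately show ?thesis using burnside_congruence[OF assms(1) Z] by simp
qed

section \<open>Configurations fixed by a symmetry\<close>

text \<open>Index \<open>n\<close> stands for the identity rotation in place of 0, because
  \<open>{0<..n}\<close> is the range in which the numbers with a given gcd with \<open>n\<close>
  are counted by the totient.\<close>

lemma bij_betw_nat_Zn:
  assumes "n > 0"
  shows "bij_betw (\<lambda>j. int j mod int n) {0<..n} (Zn n)"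
proof (rule bij_betwI[where g = "\<lambda>i. if i = 0 then n else nat i"])
  show "(if int j mod int n = 0 then n else nat (int j mod int n)) = j" if "j \<in> {0<..n}" for j
    using that by (cases "j = n") (auto simp: zmod_int nat_mod_as_int[symmetric])
qed (use assms in \<open>auto simp: Zn_def\<close>)

lemma div_pos_if_dvd: "(d::nat) dvd n \<Longrightarrow> n > 0 \<Longrightarrow> n div d > 0"
  by (auto simp: dvd_def)

lemma dvd_div_self: "(d::nat) dvd n \<Longrightarrow> n div d dvd n"
  by (metis dvd_def dvd_div_mult_self)

text \<open>Rotations by \<open>j\<close> and by \<open>gcd j n\<close> fix the same configurations,
  and exactly \<open>totient d\<close> indices have gcd \<open>n div d\<close> with
  \<open>n\<close>.\<close>

lemma sum_fixed_rotations:
  assumes "n > 0" "Y \<subseteq> configs n"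
  shows "(\<Sum>j\<in>Zn n. card {c \<in> Y. rotate_config n j c = c})
    = (\<Sum>d | d dvd n. totient d * card {c \<in> Y. rotate_config n (int (n div d)) c = c})"
proof -
  let ?f = "\<lambda>j. card {c \<in> Y. rotate_config n j c = c}"
  let ?D = "{d. d dvd n}"
  have gcd: "?f (int j) = ?f (int (gcd j n))" for j
    using assms rotate_config_gcd[of _ n "int j"] by (intro arg_cong[where f = card]) auto
  have "(\<Sum>j\<in>Zn n. ?f j) = (\<Sum>j\<in>{0<..n}. ?f (int j mod int n))"
    by (rule sum.reindex_bij_betw[OF bij_betw_nat_Zn[OF assms(1)], symmetric])
  also have "\<dots> = (\<Sum>j\<in>{0<..n}. ?f (int (gcd j n)))"
    by (simp only: rotate_config_mod gcd[symmetric])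
  also have "\<dots> = (\<Sum>d\<in>?D. \<Sum>j\<in>{j\<in>{0<..n}. n div gcd j n = d}. ?f (int (gcd j n)))"
    using assms(1) by (intro sum.group[symmetric]) (auto intro: div_dvd_iff_mult[THEN iffD2])
  also have "\<dots> = (\<Sum>d\<in>?D. totient d * ?f (int (n div d)))"
  proof (rule sum.cong)
    fix d assume "d \<in> ?D"
    then have d: "d dvd n" by simp
    then have dd: "n div (n div d) = d" using assms(1) by (simp add: div_div_eq_right)
    have "{j \<in> {0<..n}. n div gcd j n = d} = {j \<in> {0<..n}. gcd j n = n div d}"
    proof -
      have "n div gcd j n = d \<longleftrightarrow> gcd j n = n div d" for j
      proof
        assume "n div gcd j n = d"
        then show "gcd j n = n div d" using assms(1) by (auto simp: div_div_eq_right)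
      qed (simp add: dd)
      then show ?thesis by simp
    qed
    moreover have "card {j \<in> {0<..n}. gcd j n = n div d} = totient d"
      using card_gcd_eq_totient[OF assms(1) dvd_div_self[OF d]] dd by simp
    ultimately show "(\<Sum>j\<in>{j\<in>{0<..n}. n div gcd j n = d}. ?f (int (gcd j n))) = totient d * ?f (int (n div d))"
      by (simp del: greaterThanAtMost_iff)
  qed simp
  finally show ?thesis .
qed

section \<open>Subsets by size, and subsets invariant under an involution\<close>

lemma sum_Pow_card:
  fixes G :: "nat \<Rightarrow> nat"
  assumes "finite T"
  shows "(\<Sum>V\<in>Pow T. G (card V)) = (\<Sum>s\<le>card T. (card T choose s) * G s)"
proof -
  have "(\<Sum>V\<in>Pow T. G (card V)) = (\<Sum>s\<le>card T. \<Sum>V\<in>{V\<in>Pow T. card V = s}. G (card V))"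
    using assms by (intro sum.group[symmetric]) (auto intro: card_mono)
  also have "\<dots> = (\<Sum>s\<le>card T. (card T choose s) * G s)"
  proof (rule sum.cong)
    fix s
    have "(\<Sum>V\<in>{V\<in>Pow T. card V = s}. G (card V)) = (\<Sum>V\<in>{V\<in>Pow T. card V = s}. G s)"
      by (rule sum.cong) auto
    then show "(\<Sum>V\<in>{V\<in>Pow T. card V = s}. G (card V)) = (card T choose s) * G s"
      using n_subsets[OF assms, of s] by simp
  qed simp
  finally show ?thesis .
qed

lemma card_Pow_card:
  assumes "finite T"
  shows "card {V \<in> Pow T. P (card V)} = (\<Sum>s\<le>card T. if P s then card T choose s else 0)"
proof -
  have "card {V \<in> Pow T. P (card V)} = (\<Sum>V\<in>Pow T. of_bool (P (card V)))"
    using assms by (simp add: Int_def)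
  also have "\<dots> = (\<Sum>s\<le>card T. (card T choose s) * of_bool (P s))"
    by (rule sum_Pow_card[OF assms])
  also have "\<dots> = (\<Sum>s\<le>card T. if P s then card T choose s else 0)"
    by (rule sum.cong) auto
  finally show ?thesis .
qed

lemma bij_betw_ones: "bij_betw (ones n) (configs n) (Pow (Zn n))"
proof (rule bij_betwI[where g = "\<lambda>S. \<lambda>i\<in>Zn n. of_bool (i \<in> S)"])
  show "(\<lambda>i\<in>Zn n. of_bool (i \<in> ones n c)) = c" if "c \<in> configs n" for c
  proof
    fix i
    show "(\<lambda>i\<in>Zn n. of_bool (i \<in> ones n c)) i = c i"
      using that PiE_mem[of c "Zn n" "\<lambda>_. {0, 1}" i]
      by (cases "i \<in> Zn n") (auto simp: ones_def configs_def PiE_def extensional_def)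
  qed
qed (auto simp: ones_def configs_def)

lemma card_configs_ones:
  "card {c \<in> configs n. P (card (ones n c))} = (\<Sum>s\<le>n. if P s then n choose s else 0)"
  using card_Collect_bij[OF bij_betw_ones, of n "\<lambda>S. P (card S)"] card_Pow_card[of "Zn n" P]
  by (simp only: card_Zn finite_Zn)

text \<open>A set invariant under an involution consists of arbitrary fixed points together with the
  orbits of an arbitrary set of smaller representatives of the two-element orbits.\<close>

lemma card_invariant_subsets:
  fixes A :: "'a::linorder set"
  assumes fin: "finite A" and im: "\<And>a. a \<in> A \<Longrightarrow> f a \<in> A" and inv: "\<And>a. a \<in> A \<Longrightarrow> f (f a) = a"
    and F: "F = {a \<in> A. f a = a}" and t: "card A = card F + 2 * t"
  shows "card {S \<in> Pow A. f ` S \<subseteq> S \<and> P (card S)}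
    = (\<Sum>s\<le>card F. (card F choose s) * (\<Sum>r\<le>t. if P (s + 2 * r) then t choose r else 0))"
proof -
  \<comment> \<open>The linear order serves to pick one point from each two-element orbit;
    \<open>F\<close>, \<open>T\<close> and the image of \<open>T\<close> then partition
    \<open>A\<close>.\<close>
  define T where "T = {a \<in> A. a < f a}"
  have finF: "finite F" and finT: "finite T" using fin by (auto simp: F T_def)
  have injf: "inj_on f A" by (metis inj_onI inv)
  have card_orbits: "card (U \<union> V \<union> f ` V) = card U + 2 * card V" if "U \<subseteq> F" "V \<subseteq> T" for U V
  proof -
    have "V \<subseteq> A" using that by (auto simp: T_def)
    then have "card (f ` V) = card V" using injf by (meson card_image inj_on_subset)
    moreover have "U \<inter> V = {}" using that by (auto simp: F T_def subset_iff)
    moreover have "(U \<union> V) \<inter> f ` V = {}"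
      using that inv by (auto simp: F T_def subset_iff) (metis less_asym)+
    moreover have "finite U" "finite V" using that finF finT finite_subset by blast+
    ultimately show ?thesis by (simp add: card_Un_disjoint)
  qed
  have A: "A = F \<union> T \<union> f ` T"
  proof (intro equalityI subsetI)
    fix a assume a: "a \<in> A"
    show "a \<in> F \<union> T \<union> f ` T"
    proof (cases a "f a" rule: linorder_cases)
      case greater
      then have "f a \<in> T" using a im inv by (simp add: T_def)
      then show ?thesis using inv[OF a] by (metis UnCI imageI)
    qed (use a in \<open>auto simp: F T_def\<close>)
  qed (use im in \<open>auto simp: F T_def\<close>)
  \<comment> \<open>With \<open>U = F\<close> and \<open>V = T\<close> the size formula describes
    all of \<open>A\<close>, which identifies \<open>t\<close> as the number of two-element
    orbits.\<close>
  have cardT: "card T = t" using card_orbits[of F T] t A by simp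
  let ?X = "Sigma (Pow F) (\<lambda>U. {V \<in> Pow T. P (card U + 2 * card V)})"
  have "bij_betw (\<lambda>(U, V). U \<union> V \<union> f ` V) ?X {S \<in> Pow A. f ` S \<subseteq> S \<and> P (card S)}"
  proof (rule bij_betwI[where g = "\<lambda>S. (S \<inter> F, S \<inter> T)"])
    show "(\<lambda>(U, V). U \<union> V \<union> f ` V) \<in> ?X \<rightarrow> {S \<in> Pow A. f ` S \<subseteq> S \<and> P (card S)}"
    proof
      fix x assume x: "x \<in> ?X"
      obtain U V where UV: "x = (U, V)" "U \<subseteq> F" "V \<subseteq> T" "P (card U + 2 * card V)"
        using x by auto
      then have "f ` U \<subseteq> U" by (auto simp: F)
      moreover have "f (f v) \<in> V" if "v \<in> V" for v using that UV inv by (auto simp: T_def subset_iff)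
      ultimately show "(\<lambda>(U, V). U \<union> V \<union> f ` V) x \<in> {S \<in> Pow A. f ` S \<subseteq> S \<and> P (card S)}"
        using UV card_orbits A by auto
    qed
    have dec: "S \<inter> F \<union> S \<inter> T \<union> f ` (S \<inter> T) = S" if S: "S \<subseteq> A" "f ` S \<subseteq> S" for S
    proof (intro equalityI subsetI)
      fix a assume a: "a \<in> S"
      show "a \<in> S \<inter> F \<union> S \<inter> T \<union> f ` (S \<inter> T)"
      proof (cases "a \<in> F \<union> T")
        case False
        then obtain b where b: "b \<in> T" "a = f b" using a S A by auto
        \<comment> \<open>Here \<open>b\<close> is the image of \<open>a\<close> under the
          involution, so invariance of \<open>S\<close> supplies it.\<close>
        then have "b \<in> S" using S a inv[of b] by (auto simp: T_def)
        then show ?thesis using b by auto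
      qed (use a in auto)
    qed (use S in auto)
    show "(\<lambda>S. (S \<inter> F, S \<inter> T)) \<in> {S \<in> Pow A. f ` S \<subseteq> S \<and> P (card S)} \<rightarrow> ?X"
    proof
      fix S assume S: "S \<in> {S \<in> Pow A. f ` S \<subseteq> S \<and> P (card S)}"
      then have "card S = card (S \<inter> F) + 2 * card (S \<inter> T)"
        using card_orbits[of "S \<inter> F" "S \<inter> T"] dec[of S] by auto
      then show "(S \<inter> F, S \<inter> T) \<in> ?X" using S by auto
    qed
    show "(\<lambda>(U, V). U \<union> V \<union> f ` V) (S \<inter> F, S \<inter> T) = S"
      if "S \<in> {S \<in> Pow A. f ` S \<subseteq> S \<and> P (card S)}" for S
      using that dec by auto
    show "((\<lambda>(U, V). U \<union> V \<union> f ` V) x \<inter> F, (\<lambda>(U, V). U \<union> V \<union> f ` V) x \<inter> T) = x"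
      if x: "x \<in> ?X" for x
    proof -
      obtain U V where x: "x = (U, V)" "U \<subseteq> F" "V \<subseteq> T" using x by auto
      have "F \<inter> T = {}" by (auto simp: F T_def)
      moreover have "f ` V \<inter> F = {}" "f ` V \<inter> T = {}"
        using x(3) inv by (auto simp: F T_def subset_iff)
      ultimately show ?thesis using x by auto
    qed
  qed
  then have "card {S \<in> Pow A. f ` S \<subseteq> S \<and> P (card S)} = card ?X"
    by (simp add: bij_betw_same_card)
  also have "\<dots> = (\<Sum>U\<in>Pow F. card {V \<in> Pow T. P (card U + 2 * card V)})"
    using finF finT by (intro card_SigmaI) auto
  also have "\<dots> = (\<Sum>U\<in>Pow F. \<Sum>r\<le>t. if P (card U + 2 * r) then t choose r else 0)"
    using card_Pow_card[OF finT, unfolded cardT] by (intro sum.cong refl)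
  also have "\<dots> = (\<Sum>s\<le>card F. (card F choose s) * (\<Sum>r\<le>t. if P (s + 2 * r) then t choose r else 0))"
    by (rule sum_Pow_card[OF finF])
  finally show ?thesis .
qed

section \<open>Configurations fixed by a reflection\<close>

lemma reflect_config_eq_iff_ones:
  assumes "c \<in> configs n" "n > 0"
  shows "reflect_config n j c = c \<longleftrightarrow> (\<lambda>i. (j - i) mod int n) ` ones n c \<subseteq> ones n c"
proof
  assume "reflect_config n j c = c"
  then show "(\<lambda>i. (j - i) mod int n) ` ones n c \<subseteq> ones n c"
    using assms mod_in_Zn[OF assms(2)] by (auto simp: reflect_config_eq_iff ones_def)
next
  assume R: "(\<lambda>i. (j - i) mod int n) ` ones n c \<subseteq> ones n c"
  have c01: "c i \<in> {0, 1}" if "i \<in> Zn n" for i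
    using that assms(1) unfolding configs_def by (meson PiE_mem)
  show "reflect_config n j c = c"
    unfolding reflect_config_eq_iff[OF assms(1)]
  proof
    fix i assume i: "i \<in> Zn n"
    let ?i = "(j - i) mod int n"
    have "?i \<in> Zn n" using assms(2) by (rule mod_in_Zn)
    \<comment> \<open>The reflection is an involution: the single inclusion, applied at
      \<open>i\<close> and at its mirror image, yields both directions of the next
      equivalence.\<close>
    moreover have "(j - ?i) mod int n = i" using i by (simp add: mod_simps)
    ultimately have "c i = 1 \<longleftrightarrow> c ?i = 1" using R i by (auto simp: ones_def)
    then show "c ?i = c i" using c01[OF i] c01[OF \<open>?i \<in> Zn n\<close>] by auto
  qed
qed

text \<open>Counts the invariant sets with size in \<open>P\<close> once \<open>s\<close> fixed points are chosen, where \<open>t\<close> is the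
  number of two-element orbits.\<close>

definition half_sum :: "(nat \<Rightarrow> bool) \<Rightarrow> nat \<Rightarrow> nat \<Rightarrow> nat" where
  "half_sum P t s = (\<Sum>r\<le>t. if P (s + 2 * r) then t choose r else 0)"

lemma card_fixed_reflection:
  assumes "n > 0" "n = card {i \<in> Zn n. (j - i) mod int n = i} + 2 * t"
  shows "card {c \<in> configs n. P (card (ones n c)) \<and> reflect_config n j c = c} =
    (\<Sum>s\<le>card {i \<in> Zn n. (j - i) mod int n = i}.
       (card {i \<in> Zn n. (j - i) mod int n = i} choose s) * half_sum P t s)"
proof -
  let ?f = "\<lambda>i. (j - i) mod int n"
  have "{c \<in> configs n. P (card (ones n c)) \<and> reflect_config n j c = c}
      = {c \<in> configs n. ?f ` ones n c \<subseteq> ones n c \<and> P (card (ones n c))}"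
    using assms(1) reflect_config_eq_iff_ones by blast
  then have "card {c \<in> configs n. P (card (ones n c)) \<and> reflect_config n j c = c}
      = card {S \<in> Pow (Zn n). ?f ` S \<subseteq> S \<and> P (card S)}"
    using card_Collect_bij[OF bij_betw_ones, of n "\<lambda>S. ?f ` S \<subseteq> S \<and> P (card S)"] by simp
  also have "\<dots> = (\<Sum>s\<le>card {i \<in> Zn n. ?f i = i}.
       (card {i \<in> Zn n. ?f i = i} choose s) * half_sum P t s)"
    unfolding half_sum_def
    using assms by (intro card_invariant_subsets) (auto simp: mod_in_Zn mod_simps)
  finally show ?thesis .
qed

text \<open>A fixed point has \<open>2 * i\<close> congruent to \<open>j\<close> modulo
  \<open>n\<close>, and \<open>2 * i\<close> is nonnegative and below \<open>2 * n\<close>, which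
  leaves two candidates.\<close>

lemma fixed_points_reflection:
  assumes "j \<in> Zn n"
  shows "{i \<in> Zn n. (j - i) mod int n = i} = {i \<in> Zn n. 2 * i = j \<or> 2 * i = j + int n}"
proof (rule Collect_cong, rule conj_cong[OF refl])
  fix i assume i: "i \<in> Zn n"
  show "(j - i) mod int n = i \<longleftrightarrow> 2 * i = j \<or> 2 * i = j + int n"
  proof (cases "i \<le> j")
    case True
    then show ?thesis using assms i by (auto simp: Zn_def)
  next
    case False
    then have "(j - i) mod int n = (j - i + int n) mod int n" by simp
    also have "\<dots> = j - i + int n" using False assms i by (intro mod_pos_pos_trivial) (auto simp: Zn_def)
    finally show ?thesis using False assms i by (auto simp: Zn_def)
  qed
qed

text \<open>For odd \<open>n\<close> exactly one of \<open>j\<close> and \<open>j + n\<close> is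
  even; for even \<open>n\<close> both have the parity of \<open>j\<close>. Geometrically, an axis
  meets one point when \<open>n\<close> is odd, and two points or none when \<open>n\<close> is
  even.\<close>

lemma card_fixed_points_reflection:
  assumes "j \<in> Zn n"
  shows "card {i \<in> Zn n. (j - i) mod int n = i} = (if odd n then 1 else if even j then 2 else 0)"
proof -
  have j: "0 \<le> j" "j < int n" using assms by (auto simp: Zn_def)
  consider "odd n" "even j" | "odd n" "odd j" | "even n" "even j" | "even n" "odd j" by blast
  then show ?thesis
  proof cases
    case 1
    then have "{i \<in> Zn n. 2 * i = j \<or> 2 * i = j + int n} = {j div 2}"
      using j by (auto simp: Zn_def) presburger+
    then show ?thesis using 1 by (simp add: fixed_points_reflection[OF assms])
  next
    case 2
    then have "{i \<in> Zn n. 2 * i = j \<or> 2 * i = j + int n} = {(j + int n) div 2}"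
      using j by (auto simp: Zn_def)
    then show ?thesis using 2 by (simp add: fixed_points_reflection[OF assms])
  next
    case 3
    then have "{i \<in> Zn n. 2 * i = j \<or> 2 * i = j + int n} = {j div 2, (j + int n) div 2}"
      using j by (auto simp: Zn_def)
    moreover have "j div 2 \<noteq> (j + int n) div 2" using 3 j by auto
    ultimately show ?thesis using 3 by (simp add: fixed_points_reflection[OF assms])
  next
    case 4
    then have "{i \<in> Zn n. 2 * i = j \<or> 2 * i = j + int n} = {}"
      by (auto simp: Zn_def) presburger
    then show ?thesis using 4 by (simp add: fixed_points_reflection[OF assms])
  qed
qed

lemma sum_parity_Zn:
  "(\<Sum>j\<in>Zn (2 * q). if even j then a else b) = q * (a + b :: nat)"
proof -
  have Zn: "Zn m = int ` {..<m}" for m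
    by (simp add: Zn_def lessThan_atLeast0 image_int_atLeastLessThan)
  have "(\<Sum>j\<in>Zn (2 * q). if even j then a else b) = (\<Sum>j<2 * q. if even j then a else b)"
    unfolding Zn by (subst sum.reindex) auto
  also have "\<dots> = q * (a + b)" by (induction q) auto
  finally show ?thesis .
qed

text \<open>Every axis meets one point and leaves \<open>n div 2\<close> mirror pairs; the two
  summands correspond to a 0 and a 1 on the axis.\<close>

lemma sum_fixed_reflections_odd:
  assumes "odd n"
  shows "(\<Sum>j\<in>Zn n. card {c \<in> configs n. P (card (ones n c)) \<and> reflect_config n j c = c})
    = n * (half_sum P (n div 2) 0 + half_sum P (n div 2) 1)"
proof -
  have "n > 0" "n = 1 + 2 * (n div 2)" using assms by (auto intro: odd_pos)
  then have "card {c \<in> configs n. P (card (ones n c)) \<and> reflect_config n j c = c}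
      = half_sum P (n div 2) 0 + half_sum P (n div 2) 1" if "j \<in> Zn n" for j
    using card_fixed_reflection[of n j "n div 2" P] assms
    by (simp add: card_fixed_points_reflection[OF that] del: One_nat_def) (simp add: atMost_Suc)
  then show ?thesis by simp
qed

text \<open>Half of the axes meet no point and leave \<open>q\<close> mirror pairs; the others meet
  two points and leave \<open>q - 1\<close> pairs. The coefficients 1, 2, 1 count the ways to place
  0, 1 or 2 ones on the axis.\<close>

lemma sum_fixed_reflections_even:
  assumes "q > 0"
  shows "(\<Sum>j\<in>Zn (2 * q). card {c \<in> configs (2 * q). P (card (ones (2 * q) c)) \<and> reflect_config (2 * q) j c = c})
    = q * (half_sum P q 0 + half_sum P (q - 1) 0 + 2 * half_sum P (q - 1) 1 + half_sum P (q - 1) 2)"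
proof -
  have *: "card {c \<in> configs (2 * q). P (card (ones (2 * q) c)) \<and> reflect_config (2 * q) j c = c}
      = (if even j then half_sum P (q - 1) 0 + 2 * half_sum P (q - 1) 1 + half_sum P (q - 1) 2
         else half_sum P q 0)" if j: "j \<in> Zn (2 * q)" for j
  proof (cases "even j")
    case True
    have "2 * q = 2 + 2 * (q - 1)" using assms by simp
    then have "card {c \<in> configs (2 * q). P (card (ones (2 * q) c)) \<and> reflect_config (2 * q) j c = c}
      = (\<Sum>s\<le>2. (2 choose s) * half_sum P (q - 1) s)"
      using card_fixed_reflection[of "2 * q" j "q - 1" P] assms True
      unfolding card_fixed_points_reflection[OF j] by simp
    then show ?thesis using True by (simp add: numeral_2_eq_2 atMost_Suc)
  next
    case False
    then show ?thesis
      using card_fixed_reflection[of "2 * q" j q P] assms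
      unfolding card_fixed_points_reflection[OF j] by simp
  qed
  show ?thesis
    by (subst sum.cong[OF refl *]) (simp_all only: sum_parity_Zn, simp only: ac_simps)
qed

section \<open>The numbers of classes\<close>

lemma fixed_rotation_eq_expand:
  assumes "n > 0" "d dvd n"
  shows "{c \<in> configs n. P (card (ones n c)) \<and> rotate_config n (int (n div d)) c = c}
    = expand_config (n div d) n ` {c \<in> configs (n div d). P (d * card (ones (n div d) c))}"
proof -
  let ?e = "expand_config (n div d) n"
  have "{c \<in> configs n. P (card (ones n c)) \<and> rotate_config n (int (n div d)) c = c}
    = {c \<in> {c \<in> configs n. rotate_config n (int (n div d)) c = c}. P (card (ones n c))}"
    by blast
  also have "\<dots> = ?e ` {c \<in> configs (n div d). P (card (ones n (?e c)))}"
    unfolding image_expand_config[OF dvd_div_self[OF assms(2)] assms(1), symmetric] by blast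
  finally show ?thesis unfolding card_ones_expand_config[OF assms] .
qed

lemma card_fixed_rotation:
  assumes "n > 0" "d dvd n"
  shows "card {c \<in> configs n. P (card (ones n c)) \<and> rotate_config n (int (n div d)) c = c}
    = (\<Sum>s\<le>n div d. if P (d * s) then n div d choose s else 0)"
proof -
  have "inj_on (expand_config (n div d) n) {c \<in> configs (n div d). P (d * card (ones (n div d) c))}"
    using inj_on_expand_config[OF dvd_div_self[OF assms(2)] assms(1)] by (rule inj_on_subset) auto
  then show ?thesis
    unfolding fixed_rotation_eq_expand[OF assms]
    using card_configs_ones[of "n div d" "\<lambda>s. P (d * s)"] by (simp only: card_image)
qed

lemma congruence_closed:
  assumes "n > 0" "\<And>c c'. (c, c') \<in> congruence n \<Longrightarrow> Q c \<Longrightarrow> Q c'"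
  shows "congruence n `` {c \<in> configs n. Q c} \<subseteq> {c \<in> configs n. Q c}"
  using assms congruence_class_subset[OF assms(1), of "configs n"] by blast

lemma ones_closed:
  assumes "n > 0"
  shows "congruence n `` {c \<in> configs n. P (card (ones n c))} \<subseteq> {c \<in> configs n. P (card (ones n c))}"
  using card_ones_congruent[OF assms] by (intro congruence_closed[OF assms]) simp

text \<open>Taking \<open>P\<close> constantly true leads to \<open>alpha_seq\<close>, and taking it
  to be equality with a fixed number leads to \<open>R_formula\<close>. The argument
  \<open>d * s\<close> arises because \<open>s\<close> ones in one period of length
  \<open>n div d\<close> are repeated \<open>d\<close> times.\<close>

lemma card_configs_ones_quotient:
  assumes "n > 0"
  shows "2 * n * card ({c \<in> configs n. P (card (ones n c))} // congruence n)
    = (\<Sum>d | d dvd n. totient d * (\<Sum>s\<le>n div d. if P (d * s) then n div d choose s else 0))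
      + (\<Sum>j\<in>Zn n. card {c \<in> configs n. P (card (ones n c)) \<and> reflect_config n j c = c})"
proof -
  let ?Y = "{c \<in> configs n. P (card (ones n c))}"
  have Y: "?Y \<subseteq> configs n" by auto
  have "{c \<in> ?Y. rotate_config n j c = c} = {c \<in> configs n. P (card (ones n c)) \<and> rotate_config n j c = c}"
    "{c \<in> ?Y. reflect_config n j c = c} = {c \<in> configs n. P (card (ones n c)) \<and> reflect_config n j c = c}" for j
    by auto
  then show ?thesis
    using burnside_congruence[OF assms Y ones_closed[OF assms]] sum_fixed_rotations[OF assms Y]
    by (simp add: card_fixed_rotation[OF assms])
qed

lemma half_sum_True: "half_sum (\<lambda>_. True) t s = 2 ^ t"
  by (simp add: half_sum_def choose_row_sum)

lemma half_sum_eq: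
  "half_sum (\<lambda>w. w = k) t s = (if s \<le> k \<and> even (k - s) then t choose ((k - s) div 2) else 0)"
proof (cases "s \<le> k \<and> even (k - s)")
  case True
  then have "s + 2 * r = k \<longleftrightarrow> r = (k - s) div 2" for r by auto
  then have "half_sum (\<lambda>w. w = k) t s = (\<Sum>r\<le>t. if r = (k - s) div 2 then t choose r else 0)"
    unfolding half_sum_def by (simp only:)
  \<comment> \<open>If \<open>(k - s) div 2\<close> exceeds \<open>t\<close>, no term of the sum
    survives, and the binomial coefficient is 0 as well.\<close>
  also have "\<dots> = t choose ((k - s) div 2)" by (simp add: binomial_eq_0)
  finally show ?thesis using True by (simp only: if_True simp_thms)
next
  case False
  then have "s + 2 * r \<noteq> k" for r by auto
  then show ?thesis using False by (auto simp: half_sum_def)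
qed

text \<open>This averages over the \<open>n\<close> reflections. For \<open>n = 2 * q + 1\<close>
  each fixes \<open>2 * 2 ^ q\<close> configurations; for \<open>n = 2 * q\<close> half of them fix
  \<open>2 ^ q\<close> and half \<open>4 * 2 ^ (q - 1)\<close>, on average
  \<open>3 * 2 ^ (q - 1)\<close>. The factor 5 + (-1)^n, which is 4 or 6, unites the two
  cases.\<close>

lemma card_symmetric_configs_quotient:
  assumes "n > 0"
  shows "of_nat (card ({c \<in> configs n. has_symmetry_diameter n c} // congruence n)) = beta_seq n"
proof -
  let ?N = "card ({c \<in> configs n. has_symmetry_diameter n c} // congruence n)"
  have N: "n * ?N = (\<Sum>j\<in>Zn n. card {c \<in> configs n. reflect_config n j c = c})"
    using card_symmetric_classes[OF assms, of "configs n"] congruence_class_subset[OF assms] by simp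
  show ?thesis
  proof (cases "even n")
    case False
    then obtain q where q: "n = 2 * q + 1" by (rule oddE)
    have "n * ?N = n * (2 * 2 ^ q)"
      using N sum_fixed_reflections_odd[OF False, of "\<lambda>_. True"] q by (simp add: half_sum_True)
    then have "?N = 2 * 2 ^ q" using assms by simp
    moreover have "(int n - 3) div 2 = int q - 1" using q by simp
    ultimately show ?thesis using False by (simp add: beta_seq_def power_int_diff)
  next
    case True
    then obtain q where q: "n = 2 * q" by (rule evenE)
    then have "q > 0" using assms by simp
    have "(\<Sum>j\<in>Zn n. card {c \<in> configs n. reflect_config n j c = c}) = q * (2 ^ q + 4 * 2 ^ (q - 1))"
      using sum_fixed_reflections_even[OF \<open>q > 0\<close>, of "\<lambda>_. True"] q by (simp add: half_sum_True)
    moreover have "n * x = q * (2 * x)" for x using q by simp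
    ultimately have "q * (2 * ?N) = q * (2 ^ q + 4 * 2 ^ (q - 1))" using N by (simp only:)
    then have "2 * ?N = 2 ^ q + 4 * 2 ^ (q - 1)"
      using \<open>q > 0\<close> by (simp only: mult_left_cancel)
    also have "\<dots> = 3 * 2 ^ q" using \<open>q > 0\<close> by (cases q) simp_all
    finally have "of_nat (2 * ?N) = (of_nat (3 * 2 ^ q) :: rat)" by (simp only:)
    then have "2 * (of_nat ?N :: rat) = 3 * 2 ^ q" by simp
    moreover have "(int n - 3) div 2 = int q - 2" using q by simp
    ultimately show ?thesis using True by (simp add: beta_seq_def power_int_diff)
  qed
qed

text \<open>The reflection part of Burnside's lemma is \<open>n\<close> times the number of classes
  with a diameter. Division by \<open>2 * n\<close> makes it half of \<open>beta_seq n\<close>, the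
  second summand of \<open>alpha_seq n\<close>.\<close>

lemma card_configs_quotient:
  assumes "n > 0"
  shows "of_nat (card (configs n // congruence n)) = alpha_seq n"
proof -
  let ?N = "card (configs n // congruence n)"
  have "2 * n * ?N = (\<Sum>d | d dvd n. totient d * 2 ^ (n div d))
      + n * card ({c \<in> configs n. has_symmetry_diameter n c} // congruence n)"
    using card_configs_ones_quotient[OF assms, of "\<lambda>_. True"]
      card_symmetric_classes[OF assms, of "configs n"] congruence_class_subset[OF assms]
    by (simp add: choose_row_sum)
  then have "of_nat (2 * n * ?N) = (of_nat ((\<Sum>d | d dvd n. totient d * 2 ^ (n div d))
      + n * card ({c \<in> configs n. has_symmetry_diameter n c} // congruence n)) :: rat)"
    by (simp only:)
  then have "2 * of_nat n * of_nat ?N = (\<Sum>d | d dvd n. of_nat (totient d) * 2 ^ (n div d)) + of_nat n * beta_seq n"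
    by (simp add: card_symmetric_configs_quotient[OF assms])
  also have "(\<Sum>d | d dvd n. of_nat (totient d) * (2::rat) ^ (n div d))
      = 2 * (\<Sum>d | d dvd n. of_nat (totient d) * 2 ^ (n div d - 1))"
    unfolding sum_distrib_left
  proof (rule sum.cong)
    fix d assume "d \<in> {d. d dvd n}"
    \<comment> \<open>Positivity allows a factor 2 to be split off without truncating the exponent
      \<open>n div d - 1\<close>.\<close>
    then have "n div d > 0" using assms div_pos_if_dvd by blast
    then show "of_nat (totient d) * (2::rat) ^ (n div d) = 2 * (of_nat (totient d) * 2 ^ (n div d - 1))"
      by (cases "n div d") auto
  qed simp
  finally have "of_nat ?N = 1 / of_nat n * (\<Sum>d | d dvd n. of_nat (totient d) * 2 ^ (n div d - 1)) + beta_seq n / 2"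
    using assms by (simp add: field_simps)
  moreover have "(int n - 3) div 2 = (int n - 5) div 2 + 1" by presburger
  ultimately show ?thesis
    by (simp add: alpha_seq_def beta_seq_def power_int_add)
qed

text \<open>The parity of \<open>k\<close> controls the ones on the axis. For odd \<open>n\<close>
  the single axis point is a one exactly when \<open>k\<close> is odd. For even \<open>n\<close> and
  even \<open>k\<close>, Pascal's rule joins the cases of zero and two ones on the axis, so both
  kinds of axes contribute equally. For even \<open>n\<close> and odd \<open>k\<close>, axes without
  points contribute nothing, and the others have exactly one of their two points equal to one, which
  makes up for the loss.\<close>

lemma sum_fixed_reflections_ones:
  assumes "n > 0" "k > 0"
  shows "(\<Sum>j\<in>Zn n. card {c \<in> configs n. card (ones n c) = k \<and> reflect_config n j c = c})
    = n * (((n - k mod 2) div 2) choose (k div 2))"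
proof (cases "even n")
  case False
  have "half_sum (\<lambda>w. w = k) (n div 2) 0 + half_sum (\<lambda>w. w = k) (n div 2) 1
      = ((n - k mod 2) div 2) choose (k div 2)"
  proof (cases "even k")
    case odd: False
    then have "(n - k mod 2) div 2 = n div 2" "(k - 1) div 2 = k div 2"
      using \<open>odd n\<close> by presburger+
    then show ?thesis using odd assms by (simp add: half_sum_eq)
  qed (use assms in \<open>simp add: half_sum_eq\<close>)
  then show ?thesis using sum_fixed_reflections_odd[OF False, of "\<lambda>w. w = k"] by simp
next
  case True
  then obtain q where q: "n = 2 * q" by (rule evenE)
  then have "q > 0" using assms by simp
  have "half_sum (\<lambda>w. w = k) q 0 + half_sum (\<lambda>w. w = k) (q - 1) 0 + 2 * half_sum (\<lambda>w. w = k) (q - 1) 1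
      + half_sum (\<lambda>w. w = k) (q - 1) 2 = 2 * (((n - k mod 2) div 2) choose (k div 2))"
  proof (cases "even k")
    case True
    then obtain l where "k = 2 * l" by (rule evenE)
    \<comment> \<open>The successor form, available since \<open>k > 0\<close>, puts the binomial
      coefficients into the shape of Pascal's rule.\<close>
    then have l: "k = 2 * Suc (l - 1)" using assms by simp
    obtain p where "q = Suc p" using \<open>q > 0\<close> gr0_implies_Suc by blast
    then show ?thesis using l by (simp add: half_sum_eq q)
  next
    case False
    then obtain l where l: "k = 2 * l + 1" by (rule oddE)
    obtain p where "q = Suc p" using \<open>q > 0\<close> gr0_implies_Suc by blast
    then show ?thesis using l by (simp add: half_sum_eq q)
  qed
  then show ?thesis using sum_fixed_reflections_even[OF \<open>q > 0\<close>, of "\<lambda>w. w = k"] q by simp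
qed

text \<open>Burnside's lemma yields a factor 1 / \<open>a\<close> before coefficients
  \<open>a div d choose (b div d)\<close>. The absorption identity for binomial coefficients, scaled
  by \<open>d\<close>, trades it for the factor 1 / \<open>b\<close> and lowers both arguments by
  one.\<close>

lemma card_configs_ones_eq_quotient:
  assumes "0 < b" "b \<le> a"
  shows "of_nat (card ({c \<in> configs a. card (ones a c) = b} // congruence a)) = R_formula a b"
proof -
  let ?N = "card ({c \<in> configs a. card (ones a c) = b} // congruence a)"
  let ?A = "((a - b mod 2) div 2) choose (b div 2)"
  have a: "a > 0" using assms by simp
  have inner: "(\<Sum>s\<le>a div d. if d * s = b then a div d choose s else 0)
      = (if d dvd b then a div d choose (b div d) else 0)" if "d dvd a" for d
  proof (cases "d dvd b")
    case True
    have "d > 0" using that a dvd_pos_nat by blast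
    then have "d * s = b \<longleftrightarrow> s = b div d" for s using True by auto
    moreover have "b div d \<le> a div d" using assms by (simp add: div_le_mono)
    ultimately show ?thesis using True by simp
  next
    case False
    then show ?thesis by (auto intro!: sum.neutral)
  qed
  have "2 * a * ?N = (\<Sum>d | d dvd a. totient d * (if d dvd b then a div d choose (b div d) else 0)) + a * ?A"
    using card_configs_ones_quotient[OF a, of "\<lambda>w. w = b"] sum_fixed_reflections_ones[OF a assms(1)]
    using sum.cong[OF refl arg_cong[where f = "(*) (totient _)", OF inner], of "{d. d dvd a}"] by simp
  \<comment> \<open>Period \<open>a div d\<close> makes the number of ones a multiple of
    \<open>d\<close>, so only common divisors of \<open>a\<close> and \<open>b\<close>
    survive.\<close>
  also have "(\<Sum>d | d dvd a. totient d * (if d dvd b then a div d choose (b div d) else 0))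
      = (\<Sum>d | d dvd gcd a b. totient d * (a div d choose (b div d)))"
    using a by (intro sum.mono_neutral_cong_right) auto
  finally have "b * (2 * a * ?N) = (\<Sum>d | d dvd gcd a b. totient d * (b * (a div d choose (b div d)))) + a * b * ?A"
    by (simp add: distrib_left sum_distrib_left mult_ac)
  also have "(\<Sum>d | d dvd gcd a b. totient d * (b * (a div d choose (b div d))))
      = (\<Sum>d | d dvd gcd a b. a * (totient d * ((a div d - 1) choose (b div d - 1))))"
  proof (rule sum.cong)
    fix d assume "d \<in> {d. d dvd gcd a b}"
    then have d: "d dvd a" "d dvd b" by auto
    then have "b div d > 0" using assms div_pos_if_dvd by blast
    from times_binomial_minus1_eq[OF this, of "a div d"]
    have "d * (b div d) * (a div d choose (b div d)) = d * (a div d) * ((a div d - 1) choose (b div d - 1))"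
      by (simp only: mult.assoc)
    then show "totient d * (b * (a div d choose (b div d))) = a * (totient d * ((a div d - 1) choose (b div d - 1)))"
      using d by simp
  qed simp
  finally have "a * (2 * b * ?N) = a * ((\<Sum>d | d dvd gcd a b. totient d * ((a div d - 1) choose (b div d - 1))) + b * ?A)"
    by (simp add: sum_distrib_left distrib_left mult_ac)
  then have "2 * b * ?N = (\<Sum>d | d dvd gcd a b. totient d * ((a div d - 1) choose (b div d - 1))) + b * ?A"
    using a by simp
  then have "of_nat (2 * b * ?N) = (of_nat ((\<Sum>d | d dvd gcd a b. totient d * ((a div d - 1) choose (b div d - 1))) + b * ?A) :: rat)"
    by (simp only:)
  then have "2 * of_nat b * of_nat ?N = (\<Sum>d | d dvd gcd a b. of_nat (totient d) * of_nat ((a div d - 1) choose (b div d - 1)))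
      + of_nat b * (of_nat ?A :: rat)"
    by simp
  then show ?thesis using assms by (simp add: R_formula_def field_simps)
qed

text \<open>The zero configuration is alone in its class, which explains the summand \<open>- 1\<close> in the
  first two formulas.\<close>

lemma card_quotient_remove_zero:
  assumes "n > 0" "Y \<subseteq> configs n" "congruence n `` Y \<subseteq> Y" and z: "(\<lambda>i\<in>Zn n. 0) \<in> Y"
  shows "card (Y // congruence n) = card ({c \<in> Y. ones n c \<noteq> {}} // congruence n) + 1"
proof -
  let ?z = "\<lambda>i\<in>Zn n. 0::nat"
  have ones_z: "ones n c = {} \<longleftrightarrow> c = ?z" if "c \<in> configs n" for c
  proof -
    have "ones n ?z = {}" by (auto simp: ones_def)
    then show ?thesis
      using that z assms(2) bij_betw_ones[of n] by (metis bij_betw_inv_into_left subsetD)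
  qed
  have cls: "congruence n `` {?z} = {?z}"
  proof -
    have "rotate_config n j ?z = ?z" "reflect_config n j ?z = ?z" for j
      using assms(1) mod_in_Zn by (auto simp: rotate_config_def reflect_config_def fun_eq_iff)
    then show ?thesis using z assms(1,2) by (subst congruence_class_eq) auto
  qed
  let ?Y = "{c \<in> Y. ones n c \<noteq> {}}"
  have Y: "Y = insert ?z ?Y" "?z \<notin> ?Y" using ones_z z assms(2) by auto
  have fin: "finite ?Y" using assms(2) finite_configs by (auto intro: finite_subset)
  have sub: "?Y \<subseteq> configs n" using assms(2) by auto
  have "congruence n `` ?Y \<subseteq> ?Y"
  proof
    fix c' assume "c' \<in> congruence n `` ?Y"
    then obtain c where c: "c \<in> ?Y" "(c, c') \<in> congruence n" by auto
    have "finite (ones n c)" "finite (ones n c')" by (simp_all add: ones_def)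
    then show "c' \<in> ?Y" using c card_ones_congruent[OF assms(1) c(2)] assms(3) by auto
  qed
  then have "of_nat (card (?Y // congruence n)) = (\<Sum>c\<in>?Y. 1 / of_nat (card (congruence n `` {c})) :: rat)"
    using assms(1) sub by (intro card_congruence_quotient)
  moreover have "of_nat (card (Y // congruence n)) = (\<Sum>c\<in>insert ?z ?Y. 1 / of_nat (card (congruence n `` {c})) :: rat)"
    using card_congruence_quotient[OF assms(1-3)] Y(1) by simp
  ultimately have "of_nat (card (Y // congruence n)) = (of_nat (card (?Y // congruence n) + 1) :: rat)"
    using fin Y(2) cls by (simp del: Collect_empty_eq)
  then show ?thesis by (simp only: of_nat_eq_iff)
qed

lemma zero_config_symmetric:
  assumes "n \<ge> 2"
  shows "(\<lambda>i\<in>Zn n. 0) \<in> configs n" "rotation_symmetric n (\<lambda>i\<in>Zn n. 0)"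
    "has_symmetry_diameter n (\<lambda>i\<in>Zn n. 0)"
proof -
  have n: "n > 0" using assms by simp
  show "(\<lambda>i\<in>Zn n. 0) \<in> configs n" by (simp add: configs_def)
  show "rotation_symmetric n (\<lambda>i\<in>Zn n. 0)"
    unfolding rotation_symmetric_def
    \<comment> \<open>The rotation by 1 is admissible because \<open>n\<close> is at least 2; on a
      single point the zero configuration would not be rotation symmetric.\<close>
    using assms mod_in_Zn[OF n] by (intro exI[of _ 1]) auto
  show "has_symmetry_diameter n (\<lambda>i\<in>Zn n. 0)"
    unfolding has_symmetry_diameter_def
    using n mod_in_Zn[OF n] by (intro bexI[of _ 0]) (auto simp: Zn_def)
qed

section \<open>The three formulas\<close>

lemma N_rot_formula:
  assumes "n \<ge> 2"
  shows "(of_nat (N_rot n) :: rat) =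
    - 1 - (\<Sum>d | d dvd n \<and> d \<ge> 2. of_int (moebius d) * alpha_seq (n div d))"
proof -
  have n: "n > 0" using assms by simp
  let ?Y = "{c \<in> configs n. rotation_symmetric n c}"
  have Y: "?Y \<subseteq> configs n" "congruence n `` ?Y \<subseteq> ?Y"
    using congruence_closed[OF n rotation_symmetric_congruent[OF n]] by auto
  have "card (?Y // congruence n) = card ({c \<in> ?Y. ones n c \<noteq> {}} // congruence n) + 1"
    using zero_config_symmetric[OF assms] by (intro card_quotient_remove_zero[OF n Y]) simp
  also have "{c \<in> ?Y. ones n c \<noteq> {}} = {c \<in> configs n. ones n c \<noteq> {} \<and> rotation_symmetric n c}" by auto
  finally have "of_nat (N_rot n) = (of_nat (card (?Y // congruence n)) - 1 :: rat)"
    by (simp add: N_rot_def)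
  also have "of_nat (card (?Y // congruence n)) = - (\<Sum>d | d dvd n \<and> d \<ge> 2. of_int (moebius d) *
        of_nat (card ({c \<in> configs n. rotate_config n (int (n div d)) c = c} // congruence n)) :: rat)"
    using card_rotation_symmetric_classes[OF n subset_refl congruence_class_subset[OF n]] .
  also have "(\<Sum>d | d dvd n \<and> d \<ge> 2. of_int (moebius d) *
        of_nat (card ({c \<in> configs n. rotate_config n (int (n div d)) c = c} // congruence n)) :: rat)
      = (\<Sum>d | d dvd n \<and> d \<ge> 2. of_int (moebius d) * alpha_seq (n div d))"
  proof (rule sum.cong)
    fix d assume "d \<in> {d. d dvd n \<and> d \<ge> 2}"
    then have d: "d dvd n" by simp
    then have m: "n div d dvd n" "n div d > 0" using n by (simp_all add: dvd_div_self div_pos_if_dvd)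
    have "card ({c \<in> configs n. rotate_config n (int (n div d)) c = c} // congruence n)
        = card (configs (n div d) // congruence (n div d))"
      using card_quotient_expand[OF m(1) n subset_refl congruence_class_subset[OF m(2)]]
      by (simp add: image_expand_config[OF m(1) n])
    then show "of_int (moebius d) *
        of_nat (card ({c \<in> configs n. rotate_config n (int (n div d)) c = c} // congruence n))
      = of_int (moebius d) * alpha_seq (n div d)"
      by (simp add: card_configs_quotient[OF m(2)])
  qed simp
  finally show ?thesis by simp
qed

lemma S_rot_formula:
  assumes "n \<ge> 2"
  shows "(of_nat (S_rot n) :: rat) =
    - 1 - (\<Sum>d | d dvd n \<and> d \<ge> 2. of_int (moebius d) * beta_seq (n div d))"
proof -
  have n: "n > 0" using assms by simp
  let ?S = "\<lambda>n. {c \<in> configs n. has_symmetry_diameter n c}"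
  have S: "?S m \<subseteq> configs m" "congruence m `` ?S m \<subseteq> ?S m" if "m > 0" for m
    using congruence_closed[OF that has_symmetry_diameter_congruent[OF that]] by auto
  let ?Y = "{c \<in> ?S n. rotation_symmetric n c}"
  have Y: "?Y \<subseteq> configs n" "congruence n `` ?Y \<subseteq> ?Y"
    using S[OF n] rotation_symmetric_congruent[OF n] by auto
  have "card (?Y // congruence n) = card ({c \<in> ?Y. ones n c \<noteq> {}} // congruence n) + 1"
    using zero_config_symmetric[OF assms] by (intro card_quotient_remove_zero[OF n Y]) simp
  also have "{c \<in> ?Y. ones n c \<noteq> {}} =
      {c \<in> configs n. ones n c \<noteq> {} \<and> rotation_symmetric n c \<and> has_symmetry_diameter n c}" by auto
  finally have "of_nat (S_rot n) = (of_nat (card (?Y // congruence n)) - 1 :: rat)"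
    by (simp add: S_rot_def)
  also have "of_nat (card (?Y // congruence n)) = - (\<Sum>d | d dvd n \<and> d \<ge> 2. of_int (moebius d) *
        of_nat (card ({c \<in> ?S n. rotate_config n (int (n div d)) c = c} // congruence n)) :: rat)"
    by (rule card_rotation_symmetric_classes[OF n S[OF n]])
  also have "(\<Sum>d | d dvd n \<and> d \<ge> 2. of_int (moebius d) *
        of_nat (card ({c \<in> ?S n. rotate_config n (int (n div d)) c = c} // congruence n)) :: rat)
      = (\<Sum>d | d dvd n \<and> d \<ge> 2. of_int (moebius d) * beta_seq (n div d))"
  proof (rule sum.cong)
    fix d assume "d \<in> {d. d dvd n \<and> d \<ge> 2}"
    then have d: "d dvd n" by simp
    then have m: "n div d dvd n" "n div d > 0" using n by (simp_all add: dvd_div_self div_pos_if_dvd)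
    have "{c \<in> ?S n. rotate_config n (int (n div d)) c = c}
        = {c \<in> expand_config (n div d) n ` configs (n div d). has_symmetry_diameter n c}"
      unfolding image_expand_config[OF m(1) n] by blast
    also have "\<dots> = expand_config (n div d) n ` ?S (n div d)"
      using has_symmetry_diameter_expand[OF m(1) n] by auto
    finally have "card ({c \<in> ?S n. rotate_config n (int (n div d)) c = c} // congruence n)
        = card (?S (n div d) // congruence (n div d))"
      using card_quotient_expand[OF m(1) n S[OF m(2)]] by simp
    then show "of_int (moebius d) *
        of_nat (card ({c \<in> ?S n. rotate_config n (int (n div d)) c = c} // congruence n))
      = of_int (moebius d) * beta_seq (n div d)"
      by (simp add: card_symmetric_configs_quotient[OF m(2)])
  qed simp
  finally show ?thesis by simp
qed

text \<open>No summand -1 appears, since \<open>k\<close> at least 1 excludes the zero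
  configuration. A period \<open>n div d\<close> forces \<open>d\<close> to divide the number of
  ones, which cuts the divisors of \<open>n\<close> down to those of \<open>gcd n k\<close>.\<close>

lemma N_rot_ones_formula:
  assumes "1 \<le> n" "1 \<le> k" "k \<le> n"
  shows "(of_nat (N_rot_ones k n) :: rat) =
    - (\<Sum>d | d dvd gcd n k \<and> d \<ge> 2. of_int (moebius d) * R_formula (n div d) (k div d))"
proof -
  have n: "n > 0" using assms by simp
  let ?Y = "{c \<in> configs n. card (ones n c) = k}"
  let ?D = "{d. d dvd n \<and> d \<ge> 2}"
  have "{c \<in> ?Y. rotation_symmetric n c} = {c \<in> configs n. card (ones n c) = k \<and> rotation_symmetric n c}"
    by auto
  then have "of_nat (N_rot_ones k n) = - (\<Sum>d\<in>?D. of_int (moebius d) *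
        of_nat (card ({c \<in> ?Y. rotate_config n (int (n div d)) c = c} // congruence n)) :: rat)"
    using card_rotation_symmetric_classes[OF n _ ones_closed[OF n], of "\<lambda>w. w = k"]
    by (simp add: N_rot_ones_def)
  also have "(\<Sum>d\<in>?D. of_int (moebius d) *
        of_nat (card ({c \<in> ?Y. rotate_config n (int (n div d)) c = c} // congruence n)) :: rat)
      = (\<Sum>d | d dvd gcd n k \<and> d \<ge> 2. of_int (moebius d) * R_formula (n div d) (k div d))"
  proof (rule sum.mono_neutral_cong_right)
    show "finite ?D" using n by (auto intro: finite_subset[of _ "{d. d dvd n}"])
    have fixed: "{c \<in> ?Y. rotate_config n (int (n div d)) c = c}
        = expand_config (n div d) n ` {c \<in> configs (n div d). d * card (ones (n div d) c) = k}"
      if "d dvd n" for d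
      using fixed_rotation_eq_expand[OF n that, of "\<lambda>w. w = k"] by simp
    show "\<forall>d\<in>?D - {d. d dvd gcd n k \<and> d \<ge> 2}. of_int (moebius d) *
        of_nat (card ({c \<in> ?Y. rotate_config n (int (n div d)) c = c} // congruence n)) = (0 :: rat)"
    proof
      fix d assume d: "d \<in> ?D - {d. d dvd gcd n k \<and> d \<ge> 2}"
      then have "{c \<in> ?Y. rotate_config n (int (n div d)) c = c} = {}" by (subst fixed) auto
      then show "of_int (moebius d) *
        of_nat (card ({c \<in> ?Y. rotate_config n (int (n div d)) c = c} // congruence n)) = (0 :: rat)"
        by (simp only: quotient_empty card.empty of_nat_0 mult_zero_right)
    qed
    fix d assume "d \<in> {d. d dvd gcd n k \<and> d \<ge> 2}"
    then have d: "d dvd n" "d dvd k" "d > 0" by auto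
    then have m: "n div d dvd n" "n div d > 0" using n by (simp_all add: dvd_div_self div_pos_if_dvd)
    have "d * w = k \<longleftrightarrow> w = k div d" for w using d by auto
    then have "{c \<in> ?Y. rotate_config n (int (n div d)) c = c}
        = expand_config (n div d) n ` {c \<in> configs (n div d). card (ones (n div d) c) = k div d}"
      using fixed[OF d(1)] by simp
    then have "card ({c \<in> ?Y. rotate_config n (int (n div d)) c = c} // congruence n)
        = card ({c \<in> configs (n div d). card (ones (n div d) c) = k div d} // congruence (n div d))"
      using card_quotient_expand[OF m(1) n _ ones_closed[OF m(2)], of "\<lambda>w. w = k div d"] by simp
    moreover have "0 < k div d" "k div d \<le> n div d"
      using d assms by (auto simp: div_greater_zero_iff div_le_mono dvd_imp_le)
    ultimately show "of_int (moebius d) *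
        of_nat (card ({c \<in> ?Y. rotate_config n (int (n div d)) c = c} // congruence n))
      = of_int (moebius d) * R_formula (n div d) (k div d)"
      by (simp add: card_configs_ones_eq_quotient)
  qed auto
  finally show ?thesis .
qed

theorem theorem2:
  shows "(\<forall>n::nat. n \<ge> 2 \<longrightarrow>
           (of_nat (N_rot n) :: rat) =
             - 1 - (\<Sum>d | d dvd n \<and> d \<ge> 2. of_int (moebius d) * alpha_seq (n div d)))
       \<and> (\<forall>n::nat. n \<ge> 2 \<longrightarrow>
           (of_nat (S_rot n) :: rat) =
             - 1 - (\<Sum>d | d dvd n \<and> d \<ge> 2. of_int (moebius d) * beta_seq (n div d)))
       \<and> (\<forall>n k :: nat. 1 \<le> n \<and> 1 \<le> k \<and> k \<le> n \<longrightarrow>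
           (of_nat (N_rot_ones k n) :: rat) =
             - (\<Sum>d | d dvd gcd n k \<and> d \<ge> 2.
                  of_int (moebius d) * R_formula (n div d) (k div d)))"
  using N_rot_formula S_rot_formula N_rot_ones_formula by blast

end
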